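(* For fixed $q$ and $m$ and for $p\in(1,+\infty)$, let $$\lambda_0^+(p)=\inf\left\{\int_0^T\left(|u'|^p+q|u|^p\right)dx\ \Big|\ u\in W_T^{1,p}(0,T),\ \int_0^T m|u|^p\,dx=1\right\},$$ $$\lambda_0^-(p)=\max\left\{-\int_0^T\left(|u'|^p+q|u|^p\right)dx\ \Big|\ u\in W_T^{1,p}(0,T),\ \int_0^T -m|u|^p\,dx=1\right\}.$$ Then $p\mapsto\lambda_0^+(p)$ and $p\mapsto\lambda_0^-(p)$ are continuous functions on $(1,+\infty)$.
   Context: Here $T>0$, $q\in C([0,T];[0,+\infty))$ with $q\not\equiv0$, and $m:[0,T]\to\mathbb{R}$ is a continuous sign-changing weight (it takes both positive and negative values). $W_T^{1,p}(0,T)=\{u\in W^{1,p}(0,T)\mid u(0)=u(T)\}$. The numbers $\lambda_0^\pm(p)$ are the smallest positive and largest negative eigenvalues of $-(\varphi_p(u'))'+q\varphi_p(u)=\lambda m\varphi_p(u)$ on $(0,T)$ with $u(0)=u(T)$, $u'(0)=u'(T)$, where $\varphi_p(s)=|s|^{p-2}s$. *)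

theory Defs
  imports "HOL-Analysis.Analysis"
begin

definition Lp_on :: "real \<Rightarrow> real set \<Rightarrow> (real \<Rightarrow> real) set" where
  "Lp_on p I = {u \<in> borel_measurable (lebesgue_on I).
     integrable (lebesgue_on I) (\<lambda>x. \<bar>u x\<bar> powr p)}"

text \<open>The space \<open>C\<^sub>c\<^sup>1\<close> of an open set \<open>I\<close>; its elements are extended by 0 to the whole line.\<close>

definition test_functions :: "real set \<Rightarrow> (real \<Rightarrow> real) set" where
  "test_functions I = {\<phi>. \<phi> C1_differentiable_on UNIV \<and>
     compact (closure {x. \<phi> x \<noteq> 0}) \<and> closure {x. \<phi> x \<noteq> 0} \<subseteq> I}"

text \<open>\<open>u\<close> and its weak derivative \<open>g\<close> both belong to \<open>L\<^sup>p\<close>; so \<open>u\<close> lies in \<open>W\<^sup>1\<^sup>,\<^sup>p\<close>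
  iff such a \<open>g\<close> exists, and then \<open>g\<close> is unique up to a null set.\<close>

definition has_weak_Lp_derivative ::
    "(real \<Rightarrow> real) \<Rightarrow> (real \<Rightarrow> real) \<Rightarrow> real \<Rightarrow> real set \<Rightarrow> bool" where
  "has_weak_Lp_derivative u g p I \<longleftrightarrow> u \<in> Lp_on p I \<and> g \<in> Lp_on p I \<and>
     (\<forall>\<phi>\<in>test_functions I.
        (LINT x|lebesgue_on I. u x * deriv \<phi> x) = - (LINT x|lebesgue_on I. g x * \<phi> x))"

definition sobolev1 :: "real \<Rightarrow> real set \<Rightarrow> (real \<Rightarrow> real) set" where
  "sobolev1 p I = {u. \<exists>g. has_weak_Lp_derivative u g p I}"

text \<open>Every class in \<open>W\<^sup>1\<^sup>,\<^sup>p(0,T)\<close> has a unique representative continuous on \<open>[0,T]\<close>, and the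
  boundary values are those of that representative; the periodic space is therefore
  described by continuous representatives.\<close>

definition sobolev1_periodic :: "real \<Rightarrow> real \<Rightarrow> (real \<Rightarrow> real) set" where
  "sobolev1_periodic p T =
     {u \<in> sobolev1 p {0<..<T}. continuous_on {0..T} u \<and> u 0 = u T}"

text \<open>The values of \<open>\<integral> |u'|\<^sup>p + q |u|\<^sup>p\<close> on the periodic functions with \<open>\<integral> w |u|\<^sup>p = 1\<close>.
  As weak derivatives agree almost everywhere, each \<open>u\<close> contributes a single value.\<close>

definition constrained_energies ::
    "real \<Rightarrow> (real \<Rightarrow> real) \<Rightarrow> (real \<Rightarrow> real) \<Rightarrow> real \<Rightarrow> real set" where
  "constrained_energies T q w p =
     {LINT x|lebesgue_on {0<..<T}. \<bar>u' x\<bar> powr p + q x * \<bar>u x\<bar> powr p | u u'.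
        u \<in> sobolev1_periodic p T \<and> has_weak_Lp_derivative u u' p {0<..<T} \<and>
        (LINT x|lebesgue_on {0<..<T}. w x * \<bar>u x\<bar> powr p) = 1}"

definition lambda_plus ::
    "real \<Rightarrow> (real \<Rightarrow> real) \<Rightarrow> (real \<Rightarrow> real) \<Rightarrow> real \<Rightarrow> real" where
  "lambda_plus T q m p = Inf (constrained_energies T q m p)"

text \<open>An attained maximum, not a supremum: \<open>Greatest\<close> is specified only if the maximum exists.\<close>

definition lambda_minus ::
    "real \<Rightarrow> (real \<Rightarrow> real) \<Rightarrow> (real \<Rightarrow> real) \<Rightarrow> real \<Rightarrow> real" where
  "lambda_minus T q m p =
     (GREATEST l. l \<in> uminus ` constrained_energies T q (\<lambda>x. - m x) p)"

end

(* Upper semicontinuity at p0: an almost-minimiser can be approximated, with its energy and mass, by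
   periodic C1 functions (truncate the derivative, then approximate it a.e. by continuous functions),
   and for a fixed C1 function the Rayleigh quotient depends continuously on p.

   Lower semicontinuity and attainment: let p_n -> p0 and let u_n be almost-minimisers for p_n.
   They are bounded and equicontinuous, so a subsequence converges uniformly. The midpoint
   (u_n + u_m) / 2 is an almost admissible competitor for the exponent min p_n p_m, so the convexity
   defect of |.|^p at (u_n', u_m') has small integral. Uniform strict convexity on compacta then makes
   u_n' a Cauchy sequence in L1; its limit is the weak derivative of the uniform limit, and Fatou's
   lemma bounds the energy. No weak compactness and no Euler-Lagrange equation is needed. With p_n = p0
   the same argument shows that the infimum is attained, hence lambda_minus q m = - lambda_plus q (-m). *)

theory Submission
  imports Defs "HOL-Complex_Analysis.Great_Picard"
begin

section \<open>Pointwise inequalities for powers\<close>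

text \<open>The function space changes with the exponent, and this shapes both halves. A
  near-minimiser for \<open>p0\<close> may have infinite energy for every larger exponent, so upper
  semicontinuity needs competitors that are admissible for all exponents at once. In the other
  direction the exponents may approach \<open>p0\<close> from below, so the derivatives need not lie
  in L^p0. Convergence in L1 is neutral with respect to the exponent, and almost everywhere
  convergence along a subsequence lets Fatou's lemma act on the powers with varying exponents
  themselves.

  Two exponents are compared through |s|^p <= |s|^p' + (1 - p/p'), whose error vanishes as p/p'
  tends to 1. The smaller of two exponents of the sequence is again an exponent of the sequence, so
  \<open>lambda_plus\<close> at the exponent of the midpoint converges without appeal to the
  continuity being proved. That \<open>q\<close> is not identically zero enters through the a priori
  bound: it prevents near-minimisers from drifting off by large constants.\<close>

lemma powr_gt_linear:
  fixes p t :: real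
  assumes "p > 1" "t \<ge> 0" "t \<noteq> 1"
  shows "t powr p > 1 + p * (t - 1)"
proof (cases "t = 0")
  case True then show ?thesis using assms by simp
next
  case False
  with assms have t: "t > 0" by simp
  have "ln (1/t) \<noteq> 1/t - 1" using ln_eq_minus_one[of "1/t"] t assms(3) by auto
  then have "ln (1/t) < 1/t - 1" using ln_le_minus_one[of "1/t"] t by auto
  then have l: "ln t > 1 - 1/t" using t by (simp add: ln_div)
  \<comment> \<open>The goal is the strict tangent-line bound for \<open>t powr p\<close> at 1, the
    source of strict convexity and of the comparison of exponents. This factorisation exposes
    \<open>1 - 1/t\<close>, which the strictly larger \<open>ln t\<close> may replace; then
    \<open>exp y >= 1 + y\<close> applies.\<close>
  have "1 + p * (t - 1) = t * (1 + (p-1) * (1 - 1/t))" using t by (simp add: field_simps)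
  also have "\<dots> < t * (1 + (p-1) * ln t)"
    using l t assms by (intro mult_strict_left_mono add_strict_left_mono) auto
  also have "\<dots> \<le> t * exp ((p-1) * ln t)"
    using t by (intro mult_left_mono) (auto intro: exp_ge_add_one_self)
  also have "\<dots> = t powr p" using t by (simp add: powr_def left_diff_distrib exp_diff)
  finally show ?thesis .
qed

text \<open>After division by the mean \<open>c\<close> of the absolute values, the linear terms of
  the two tangent-line bounds cancel. If the absolute values agree, then \<open>a = - b\<close> is
  nonzero and the midpoint is 0.\<close>

lemma powr_midpoint_less:
  fixes p a b :: real
  assumes "p > 1" "a \<noteq> b"
  shows "\<bar>(a + b) / 2\<bar> powr p < (\<bar>a\<bar> powr p + \<bar>b\<bar> powr p) / 2"
proof (cases "\<bar>a\<bar> = \<bar>b\<bar>")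
  case True
  with assms have "a = - b" "b \<noteq> 0" by auto
  then show ?thesis using assms by simp
next
  case False
  define c where "c = (\<bar>a\<bar> + \<bar>b\<bar>) / 2"
  have c: "c > 0" using False unfolding c_def by (auto simp: abs_if split: if_splits)
  have "\<bar>a\<bar> / c \<noteq> 1" "\<bar>b\<bar> / c \<noteq> 1" using c False unfolding c_def by (auto simp: field_simps)
  then have "1 + p * (\<bar>a\<bar> / c - 1) < (\<bar>a\<bar> / c) powr p" "1 + p * (\<bar>b\<bar> / c - 1) < (\<bar>b\<bar> / c) powr p"
    using c assms by (auto intro!: powr_gt_linear)
  moreover have "\<bar>a\<bar> / c - 1 + (\<bar>b\<bar> / c - 1) = 0" using c unfolding c_def by (simp add: field_simps)
  then have "p * (\<bar>a\<bar> / c - 1) + p * (\<bar>b\<bar> / c - 1) = 0" by (metis distrib_left mult_zero_right)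
  ultimately have "2 < (\<bar>a\<bar> / c) powr p + (\<bar>b\<bar> / c) powr p" by linarith
  then have "2 * c powr p < \<bar>a\<bar> powr p + \<bar>b\<bar> powr p" using c by (simp add: powr_divide field_simps)
  moreover have "\<bar>(a + b) / 2\<bar> powr p \<le> c powr p"
    unfolding c_def using assms by (intro powr_mono2) auto
  ultimately show ?thesis by simp
qed

lemma powr_midpoint_le:
  fixes p a b :: real
  assumes "p > 1"
  shows "\<bar>(a + b) / 2\<bar> powr p \<le> (\<bar>a\<bar> powr p + \<bar>b\<bar> powr p) / 2"
  using powr_midpoint_less[OF assms, of a b] by (cases "a = b") auto

text \<open>A form of Young's inequality: the tangent-line bound at \<open>t = |s| powr p\<close>
  with exponent \<open>p'/p\<close>, multiplied by \<open>p/p'\<close>. It lets the exponent be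
  lowered on a finite measure space at an additive cost that disappears when the two exponents
  merge.\<close>

lemma powr_le_powr_add:
  fixes s p p' :: real
  assumes "0 < p" "p \<le> p'"
  shows "\<bar>s\<bar> powr p \<le> \<bar>s\<bar> powr p' + (1 - p / p')"
proof (cases "p = p' \<or> \<bar>s\<bar> powr p = 1")
  case True
  then show ?thesis
  proof
    assume "\<bar>s\<bar> powr p = 1"
    moreover have "\<bar>s\<bar> = (\<bar>s\<bar> powr p) powr (1/p)" using assms by (simp add: powr_powr)
    ultimately have "\<bar>s\<bar> = 1" by simp
    then show ?thesis using assms by (simp add: divide_le_eq)
  qed auto
next
  case False
  define t where "t = \<bar>s\<bar> powr p"
  have "1 + p'/p * (t - 1) < t powr (p'/p)"
    using False assms by (intro powr_gt_linear) (auto simp: t_def)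
  also have "t powr (p'/p) = \<bar>s\<bar> powr p'" using assms by (simp add: t_def powr_powr)
  finally have "p/p' * (1 + p'/p * (t - 1)) \<le> p/p' * \<bar>s\<bar> powr p'"
    using assms by (intro mult_left_mono) auto
  also have "\<dots> \<le> 1 * \<bar>s\<bar> powr p'" using assms by (intro mult_right_mono) auto
  finally have "p/p' * (1 + p'/p * (t - 1)) \<le> \<bar>s\<bar> powr p'" by simp
  moreover have "p/p' * (1 + p'/p * (t - 1)) = p/p' + (t - 1)" using assms by (simp add: field_simps)
  ultimately show ?thesis by (simp add: t_def)
qed

section \<open>Uniform superlinearity and uniform strict convexity\<close>

lemma abs_le_powr:
  fixes s p r C :: real
  assumes "1 < r" "r \<le> p" "C \<ge> 1" "\<bar>s\<bar> \<ge> C"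
  shows "\<bar>s\<bar> \<le> \<bar>s\<bar> powr p / C powr (r - 1)"
proof -
  have "C powr (r-1) \<le> \<bar>s\<bar> powr (r - 1)" using assms by (intro powr_mono2) auto
  also have "\<dots> \<le> \<bar>s\<bar> powr (p - 1)" using assms by (intro powr_mono) auto
  finally have "\<bar>s\<bar> * C powr (r-1) \<le> \<bar>s\<bar> * \<bar>s\<bar> powr (p-1)" by (intro mult_left_mono) auto
  also have "\<dots> = \<bar>s\<bar> powr p" using assms by (simp add: powr_mult_base)
  finally show ?thesis using assms by (simp add: pos_le_divide_eq)
qed

lemma exists_large_powr:
  fixes r e :: real
  assumes "1 < r" "e > 0"
  obtains C where "C \<ge> 1" "1 / C powr (r - 1) \<le> e"
proof
  let ?C = "max 1 ((1/e) powr (1/(r-1)))"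
  show "?C \<ge> 1" by simp
  have "1/e = ((1/e) powr (1/(r-1))) powr (r-1)" using assms by (simp add: powr_powr)
  also have "\<dots> \<le> ?C powr (r-1)" using assms by (intro powr_mono2) auto
  finally show "1 / ?C powr (r-1) \<le> e" using assms by (simp add: field_simps)
qed

text \<open>One constant \<open>C\<close> serves all exponents from \<open>r\<close> on. This is the
  criterion of de la Vallee-Poussin in pointwise form; it makes derivatives with bounded energies
  uniformly integrable.\<close>

lemma abs_le_eps_powr:
  fixes r e :: real
  assumes "1 < r" "e > 0"
  obtains C where "C \<ge> 1" "\<And>s p. r \<le> p \<Longrightarrow> \<bar>s\<bar> \<le> e * \<bar>s\<bar> powr p + C"
proof -
  obtain C where C: "C \<ge> 1" "1 / C powr (r - 1) \<le> e" using exists_large_powr[OF assms] .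
  show ?thesis
  proof
    show "C \<ge> 1" by fact
    fix s p :: real assume p: "r \<le> p"
    show "\<bar>s\<bar> \<le> e * \<bar>s\<bar> powr p + C"
    proof (cases "\<bar>s\<bar> \<ge> C")
      case True
      have "\<bar>s\<bar> \<le> 1 / C powr (r - 1) * \<bar>s\<bar> powr p" using abs_le_powr[OF assms(1) p C(1) True] by simp
      also have "\<dots> \<le> e * \<bar>s\<bar> powr p" using C by (intro mult_right_mono) auto
      finally show ?thesis using C by simp
    next
      case False then show ?thesis using assms by (simp add: add_increasing)
    qed
  qed
qed

text \<open>A quantitative form of strict convexity, uniform in the exponent: the bounded part comes from
  compactness, the unbounded part from superlinear growth.\<close>

lemma abs_diff_le_convexity_defect:
  fixes r P e :: real
  assumes "1 < r" "e > 0"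
  obtains C where "C \<ge> 0"
    "\<And>p a b. r \<le> p \<Longrightarrow> p \<le> P \<Longrightarrow> \<bar>a - b\<bar> \<le> e * (1 + \<bar>a\<bar> powr p + \<bar>b\<bar> powr p)
        + C * ((\<bar>a\<bar> powr p + \<bar>b\<bar> powr p) / 2 - \<bar>(a + b) / 2\<bar> powr p)"
proof -
  obtain N where N: "N \<ge> 1" "1 / N powr (r - 1) \<le> e / 2"
    using exists_large_powr[of r "e/2"] assms by auto
  \<comment> \<open>The convexity defect as a function of \<open>(p, a, b)\<close>. It is continuous
    and positive on the compact set \<open>K\<close> of bounded pairs at distance at least
    \<open>e\<close>, hence bounded below there by some \<open>h > 0\<close>.\<close>
  define d where "d = (\<lambda>z::real\<times>real\<times>real.
     (\<bar>fst (snd z)\<bar> powr fst z + \<bar>snd (snd z)\<bar> powr fst z) / 2 - \<bar>(fst (snd z) + snd (snd z)) / 2\<bar> powr fst z)"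
  define K where "K = ({r..P} \<times> {-N..N} \<times> {-N..N}) \<inter> {z. e \<le> \<bar>fst (snd z) - snd (snd z)\<bar>}"
  have cK: "compact K" unfolding K_def
    by (intro compact_Int_closed compact_Times closed_Collect_le continuous_intros compact_Icc)
  have cd: "continuous_on K d" unfolding d_def
    by (intro continuous_intros continuous_on_powr') (use assms in \<open>auto simp: K_def\<close>)
  have dpos: "d z > 0" if "z \<in> K" for z
    using that assms powr_midpoint_less[of "fst z" "fst (snd z)" "snd (snd z)"]
    by (auto simp: K_def d_def)
  obtain h where h: "h > 0" "\<And>z. z \<in> K \<Longrightarrow> h \<le> d z"
  proof (cases "K = {}")
    case True then show ?thesis using that[of 1] by simp
  next
    case False
    obtain z where "z \<in> K" "\<And>y. y \<in> K \<Longrightarrow> d z \<le> d y"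
      using continuous_attains_inf[OF cK False cd] by blast
    then show ?thesis using that[of "d z"] dpos by blast
  qed
  show ?thesis
  proof
    \<comment> \<open>On \<open>K\<close> the distance is at most \<open>2 * N\<close> and the
      defect at least \<open>h\<close>, so this ratio times the defect dominates the
      distance.\<close>
    show "2 * N / h \<ge> 0" using N h by simp
    fix p a b :: real assume p: "r \<le> p" "p \<le> P"
    have p1: "p > 1" using p assms by simp
    note mid = powr_midpoint_le[OF p1, of a b]
    \<comment> \<open>If the larger absolute value reaches \<open>N\<close>, superlinearity alone
      absorbs the distance into the \<open>e\<close> term.\<close>
    have aux: "\<bar>x - y\<bar> \<le> e * (1 + \<bar>x\<bar> powr p + \<bar>y\<bar> powr p)" if "\<bar>x\<bar> \<ge> \<bar>y\<bar>" "\<bar>x\<bar> \<ge> N" for x y :: real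
    proof -
      have "\<bar>x - y\<bar> \<le> 2 * \<bar>x\<bar>" using that by linarith
      also have "\<dots> \<le> 2 * (1 / N powr (r - 1) * \<bar>x\<bar> powr p)"
        using abs_le_powr[OF assms(1) p(1) N(1) that(2)] by simp
      also have "\<dots> \<le> 2 * (e / 2 * \<bar>x\<bar> powr p)" using N by (intro mult_left_mono mult_right_mono) auto
      also have "\<dots> \<le> e * (1 + \<bar>x\<bar> powr p + \<bar>y\<bar> powr p)" using assms by simp
      finally show ?thesis .
    qed
    show "\<bar>a - b\<bar> \<le> e * (1 + \<bar>a\<bar> powr p + \<bar>b\<bar> powr p)
        + 2 * N / h * ((\<bar>a\<bar> powr p + \<bar>b\<bar> powr p) / 2 - \<bar>(a + b) / 2\<bar> powr p)"
    proof (cases "\<bar>a - b\<bar> \<le> e * (1 + \<bar>a\<bar> powr p + \<bar>b\<bar> powr p)")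
      case True
      moreover have "0 \<le> 2 * N / h * ((\<bar>a\<bar> powr p + \<bar>b\<bar> powr p) / 2 - \<bar>(a + b) / 2\<bar> powr p)"
        using mid N h by (intro mult_nonneg_nonneg) auto
      ultimately show ?thesis by linarith
    next
      case False
      \<comment> \<open>Failure of the \<open>e\<close> bound confines both numbers to the bounded
        box; it also separates them by more than \<open>e\<close>, so the point lies in
        \<open>K\<close>.\<close>
      have "\<bar>a\<bar> < N" "\<bar>b\<bar> < N" using aux[of a b] aux[of b a] False
        by (auto simp: abs_minus_commute add_ac not_le[symmetric] le_less_linear)
           (metis abs_minus_commute add.commute add.left_commute linorder_le_cases order_trans)+
      moreover have "e * 1 \<le> e * (1 + \<bar>a\<bar> powr p + \<bar>b\<bar> powr p)" using assms by (intro mult_left_mono) auto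
      then have "e \<le> \<bar>a - b\<bar>" using False by linarith
      ultimately have "(p, a, b) \<in> K" using p by (auto simp: K_def)
      then have "h \<le> d (p, a, b)" using h by blast
      then have "2 * N / h * h \<le> 2 * N / h * d (p, a, b)" using h N by (intro mult_left_mono) auto
      then have "2 * N \<le> 2 * N / h * d (p, a, b)" using h by simp
      moreover have "\<bar>a - b\<bar> \<le> 2 * N" using \<open>\<bar>a\<bar> < N\<close> \<open>\<bar>b\<bar> < N\<close> by linarith
      moreover have "0 \<le> e * (1 + \<bar>a\<bar> powr p + \<bar>b\<bar> powr p)" using assms by simp
      ultimately show ?thesis by (simp add: d_def)
    qed
  qed
qed

section \<open>Integration on a bounded interval\<close>

abbreviation leb :: "real \<Rightarrow> real measure" where
  "leb T \<equiv> lebesgue_on {0<..<T}"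

lemma finite_measure_leb: "finite_measure (leb T)"
  by (rule finite_measureI) (cases "0 \<le> T"; simp add: emeasure_restrict_space)

lemma measure_leb: "T > 0 \<Longrightarrow> measure (leb T) {0<..<T} = T"
  by (simp add: measure_restrict_space)

lemma integrable_const_leb: "integrable (leb T) (\<lambda>x. c :: real)"
  using finite_measure.integrable_const[OF finite_measure_leb] .

lemma LINT_const_leb: "T > 0 \<Longrightarrow> (LINT x|leb T. c) = T * (c::real)"
  by (simp add: measure_leb)

lemma borel_measurable_leb_continuous:
  fixes f :: "real \<Rightarrow> real"
  assumes "continuous_on {0..T} f" shows "f \<in> borel_measurable (leb T)"
  by (rule continuous_imp_measurable_on_sets_lebesgue)
     (auto intro: continuous_on_subset[OF assms])

lemma continuous_bounded_Icc:
  fixes f :: "real \<Rightarrow> real"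
  assumes "continuous_on {a..b} f"
  obtains B where "B \<ge> 1" "\<And>x. x \<in> {a..b} \<Longrightarrow> \<bar>f x\<bar> \<le> B"
proof -
  have "bounded (f ` {a..b})"
    using assms compact_continuous_image compact_imp_bounded by blast
  then obtain B where "\<forall>y\<in>f ` {a..b}. norm y \<le> B" by (auto simp: bounded_iff)
  then show ?thesis by (intro that[of "max 1 B"]) force+
qed

lemma integrable_leb_bounded:
  fixes f :: "real \<Rightarrow> real"
  assumes "f \<in> borel_measurable (leb T)" "\<And>x. x \<in> {0<..<T} \<Longrightarrow> \<bar>f x\<bar> \<le> B"
  shows "integrable (leb T) f"
  by (rule Bochner_Integration.integrable_bound[OF integrable_const_leb[of T B]])
     (use assms in \<open>fastforce intro!: AE_I2\<close>)+

lemma integrable_leb_mult_bounded: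
  fixes f g :: "real \<Rightarrow> real"
  assumes "integrable (leb T) g" "f \<in> borel_measurable (leb T)" "\<And>x. x \<in> {0<..<T} \<Longrightarrow> \<bar>f x\<bar> \<le> B"
  shows "integrable (leb T) (\<lambda>x. f x * g x)"
proof (rule Bochner_Integration.integrable_bound[where f = "\<lambda>x. B * \<bar>g x\<bar>"])
  show "AE x in leb T. norm (f x * g x) \<le> norm (B * \<bar>g x\<bar>)"
  proof (rule AE_I2)
    fix x assume "x \<in> space (leb T)"
    then have "\<bar>f x\<bar> \<le> \<bar>B\<bar>" using assms(3)[of x] by simp
    then show "norm (f x * g x) \<le> norm (B * \<bar>g x\<bar>)" by (simp add: abs_mult mult_right_mono)
  qed
qed (use assms in auto)

lemma integrable_leb_continuous:
  fixes f :: "real \<Rightarrow> real"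
  assumes "continuous_on {0..T} f" shows "integrable (leb T) f"
proof -
  obtain B where "\<And>x. x \<in> {0..T} \<Longrightarrow> \<bar>f x\<bar> \<le> B" using continuous_bounded_Icc[OF assms] by metis
  then show ?thesis
    by (intro integrable_leb_bounded[where B = B] borel_measurable_leb_continuous assms) auto
qed

text \<open>Bridge from the Lebesgue integral over the open interval to the gauge integral over the
  closed one, where the fundamental theorem of calculus applies. The two endpoints are
  negligible.\<close>

lemma leb_integrable_imp_absolutely_integrable:
  fixes f :: "real \<Rightarrow> real"
  assumes "integrable (leb T) f"
  shows "f absolutely_integrable_on {0..T}"
proof -
  have "f absolutely_integrable_on {0<..<T}"
    using assms by (simp add: absolutely_integrable_on_def set_integrable_def integrable_restrict_space)
  then show ?thesis
    by (rule absolutely_integrable_spike_set)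
       (auto intro: negligible_subset[of "{0,T}"])
qed

lemma LINT_leb_eq_integral:
  fixes f :: "real \<Rightarrow> real"
  assumes "integrable (leb T) f"
  shows "(LINT x|leb T. f x) = integral {0..T} f"
  using lebesgue_integral_eq_integral[OF assms] by (simp add: integral_open_interval_real)

lemma indicator_measurable_leb: "indicat_real {a<..b} \<in> borel_measurable (leb T)"
  by (intro measurable_restrict_space1 borel_measurable_indicator) auto

lemma integrable_indicator_mult:
  fixes f :: "real \<Rightarrow> real"
  assumes "integrable (leb T) f"
  shows "integrable (leb T) (\<lambda>t. indicator {a<..b} t * f t)"
  by (rule integrable_leb_mult_bounded[OF assms indicator_measurable_leb, where B = 1]) (simp add: indicator_def)

lemma LINT_leb_indicator:
  fixes f :: "real \<Rightarrow> real"
  assumes "integrable (leb T) f" "0 \<le> a" "a \<le> b" "b \<le> T"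
  shows "(LINT x|leb T. indicator {a<..b} x * f x) = integral {a..b} f"
proof -
  have "(LINT x|leb T. indicator {a<..b} x * f x) = integral {0..T} (\<lambda>x. indicator {a<..b} x * f x)"
    by (rule LINT_leb_eq_integral[OF integrable_indicator_mult[OF assms(1)]])
  also have "\<dots> = integral {0..T} (\<lambda>x. if x \<in> {a..b} then f x else 0)"
    by (rule integral_spike[of "{a}"]) (auto simp: indicator_def)
  also have "\<dots> = integral {a..b} f"
    using assms by (subst integral_restrict_Int) (simp add: Int_absorb2 inf.absorb2)
  finally show ?thesis .
qed

text \<open>Passing through the nonnegative integral makes integrability of the limit a conclusion.
  The bounds \<open>c n\<close> may vary, as energies along a minimising sequence do.\<close>

lemma Fatou_real:
  fixes f :: "nat \<Rightarrow> 'a \<Rightarrow> real" and h :: "'a \<Rightarrow> real" and c :: "nat \<Rightarrow> real"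
  assumes int: "\<And>n. integrable M (f n)" and nonneg: "\<And>n x. x \<in> space M \<Longrightarrow> 0 \<le> f n x"
    and meas: "h \<in> borel_measurable M"
    and lim: "AE x in M. (\<lambda>n. f n x) \<longlonglongrightarrow> h x"
    and le: "\<And>n. integral\<^sup>L M (f n) \<le> c n" and c: "c \<longlonglongrightarrow> l"
  shows "integrable M h" "integral\<^sup>L M h \<le> l"
proof -
  have h0: "AE x in M. 0 \<le> h x"
    using lim AE_space by eventually_elim (use nonneg in \<open>auto intro: LIMSEQ_le_const\<close>)
  have c0: "0 \<le> c n" for n
  proof -
    have "0 \<le> integral\<^sup>L M (f n)" by (rule Bochner_Integration.integral_nonneg) (rule nonneg)
    then show ?thesis using le[of n] by simp
  qed
  then have l0: "0 \<le> l" using LIMSEQ_le_const[OF c] by blast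
  have "(\<integral>\<^sup>+ x. ennreal (h x) \<partial>M) = (\<integral>\<^sup>+ x. liminf (\<lambda>n. ennreal (f n x)) \<partial>M)"
    by (rule nn_integral_cong_AE)
       (use lim in eventually_elim, rule sym, auto intro!: lim_imp_Liminf tendsto_ennrealI)
  also have "\<dots> \<le> liminf (\<lambda>n. \<integral>\<^sup>+ x. ennreal (f n x) \<partial>M)"
    using int by (intro nn_integral_liminf) auto
  also have "\<dots> \<le> liminf (\<lambda>n. ennreal (c n))"
  proof (intro Liminf_mono always_eventually allI)
    fix n
    have "(\<integral>\<^sup>+ x. ennreal (f n x) \<partial>M) = ennreal (integral\<^sup>L M (f n))"
      using nonneg by (intro nn_integral_eq_integral int) (auto intro: AE_I2)
    then show "(\<integral>\<^sup>+ x. ennreal (f n x) \<partial>M) \<le> ennreal (c n)" using le by (simp add: ennreal_leI)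
  qed
  also have "\<dots> = ennreal l" using c by (intro lim_imp_Liminf tendsto_ennrealI) auto
  finally have fin: "(\<integral>\<^sup>+ x. ennreal (h x) \<partial>M) \<le> ennreal l" .
  show "integrable M h"
    by (rule integrableI_nonneg[OF meas h0]) (use fin in \<open>auto intro: le_less_trans\<close>)
  then have "ennreal (integral\<^sup>L M h) \<le> ennreal l"
    using fin by (simp add: nn_integral_eq_integral h0)
  then show "integral\<^sup>L M h \<le> l" using l0 by (simp add: ennreal_le_iff)
qed

section \<open>Smooth steps and the lemma of du Bois-Reymond\<close>

text \<open>The block from which C1 cut-offs are assembled. Only the origin needs an argument: the
  difference quotient there is at most \<open>|h|\<close>.\<close>

lemma DERIV_max_sq: "((\<lambda>t. (max 0 t)^2 / 2) has_real_derivative max 0 x) (at x)"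
  for x :: real
proof -
  consider "x < 0" | "x > 0" | "x = 0" by linarith
  then show ?thesis
  proof cases
    case 1
    have "((\<lambda>t. 0) has_real_derivative 0) (at x)" by simp
    then have "((\<lambda>t. (max 0 t)^2 / 2) has_real_derivative 0) (at x)"
      by (rule has_field_derivative_transform_within_open[where S = "{..<0}"]) (use 1 in auto)
    then show ?thesis using 1 by simp
  next
    case 2
    have "((\<lambda>t. t^2/2) has_real_derivative x) (at x)" by (auto intro!: derivative_eq_intros)
    then have "((\<lambda>t. (max 0 t)^2 / 2) has_real_derivative x) (at x)"
      by (rule has_field_derivative_transform_within_open[where S = "{0<..}"]) (use 2 in auto)
    then show ?thesis using 2 by simp
  next
    case 3
    have "(\<lambda>h. max 0 h ^ 2 / 2 / h) \<midarrow>0\<rightarrow> (0::real)"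
    proof (rule Lim_null_comparison[of _ "\<lambda>h. \<bar>h\<bar>"])
      have "norm (max 0 h ^ 2 / 2 / h) \<le> \<bar>h\<bar>" for h :: real
        by (cases "h > 0") (auto simp: power2_eq_square)
      then show "\<forall>\<^sub>F h in at 0. norm (max 0 h ^ 2 / 2 / h) \<le> \<bar>h\<bar>" by (auto intro: always_eventually)
      show "(\<lambda>h::real. \<bar>h\<bar>) \<midarrow>0\<rightarrow> 0" by (auto intro!: tendsto_eq_intros)
    qed
    then show ?thesis using 3 by (simp add: DERIV_def)
  qed
qed

text \<open>A quadratic spline, the primitive of \<open>tent\<close>, rising from 0 at
  \<open>t = 0\<close> to 1 at \<open>t = 2\<close>. Its C1 regularity is exactly that of
  \<open>test_functions\<close>.\<close>

definition smooth_step :: "real \<Rightarrow> real" where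
  "smooth_step t = (max 0 t)^2 / 2 - 2 * ((max 0 (t - 1))^2 / 2) + (max 0 (t - 2))^2 / 2"

text \<open>The hat of height 1 and unit area on the interval from 0 to 2, written as a second
  difference of positive parts.\<close>

definition tent :: "real \<Rightarrow> real" where
  "tent t = max 0 t - 2 * max 0 (t - 1) + max 0 (t - 2)"

lemma DERIV_smooth_step: "(smooth_step has_real_derivative tent t) (at t)"
proof -
  have shift: "((\<lambda>t. (max 0 (t - c))^2 / 2) has_real_derivative max 0 (t - c)) (at t)" for c
    using DERIV_shift[of "\<lambda>t. (max 0 t)^2 / 2" "max 0 (t - c)" t "-c"] DERIV_max_sq[of "t - c"] by simp
  show ?thesis unfolding smooth_step_def[abs_def] tent_def
    by (intro DERIV_add DERIV_diff DERIV_cmult shift DERIV_max_sq)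
qed

lemma smooth_step_eq_0: "t \<le> 0 \<Longrightarrow> smooth_step t = 0"
  by (simp add: smooth_step_def)

lemma smooth_step_eq_1: "t \<ge> 2 \<Longrightarrow> smooth_step t = 1"
  by (simp add: smooth_step_def power2_eq_square field_simps)

lemma tent_nonneg: "tent t \<ge> 0"
  by (auto simp: tent_def max_def)

lemma tent_eq_0: "t \<le> 0 \<or> t \<ge> 2 \<Longrightarrow> tent t = 0"
  by (auto simp: tent_def max_def)

lemma continuous_tent [continuous_intros]: "continuous_on A f \<Longrightarrow> continuous_on A (\<lambda>x. tent (f x))"
  unfolding tent_def by (intro continuous_intros)

lemma smooth_step_mono: "s \<le> t \<Longrightarrow> smooth_step s \<le> smooth_step t"
  using DERIV_nonneg_imp_nondecreasing[of s t smooth_step] DERIV_smooth_step tent_nonneg by blast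

lemma smooth_step_bounds: "0 \<le> smooth_step t" "smooth_step t \<le> 1"
  using smooth_step_mono[of "min t 0" t] smooth_step_mono[of t "max t 2"]
  by (auto simp: smooth_step_eq_0 smooth_step_eq_1)

lemma smooth_step_pos: "t > 0 \<Longrightarrow> smooth_step t > 0"
proof -
  assume "t > 0"
  then have "0 < smooth_step (min t 1)" by (simp add: smooth_step_def)
  also have "\<dots> \<le> smooth_step t" by (intro smooth_step_mono) auto
  finally show ?thesis .
qed

text \<open>Both ramps start at their base points and extend \<open>2 / k\<close> to the right.
  Hence the support lies between \<open>a\<close> and \<open>b + 2 / k\<close>, the limit for large
  \<open>k\<close> is the indicator of the half-open interval \<open>{a<..b}\<close>, and the
  derivative is a difference of two hats of unit mass at \<open>a\<close> and
  \<open>b\<close>.\<close>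

definition plateau :: "real \<Rightarrow> real \<Rightarrow> real \<Rightarrow> real \<Rightarrow> real" where
  "plateau a b k x = smooth_step (k * (x - a)) - smooth_step (k * (x - b))"

lemma DERIV_plateau:
  "(plateau a b k has_real_derivative k * tent (k * (x - a)) - k * tent (k * (x - b))) (at x)"
  unfolding plateau_def[abs_def]
  by (auto intro!: derivative_eq_intros DERIV_chain2[OF DERIV_smooth_step])

lemma continuous_plateau [continuous_intros]: "continuous_on A (plateau a b k)"
  using DERIV_plateau by (intro DERIV_continuous_on) (blast intro: DERIV_subset)

lemma plateau_nonneg: "k \<ge> 0 \<Longrightarrow> a \<le> b \<Longrightarrow> plateau a b k x \<ge> 0"
  unfolding plateau_def by (simp add: smooth_step_mono mult_left_mono)

lemma plateau_le_1: "\<bar>plateau a b k x\<bar> \<le> 1"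
  using smooth_step_bounds[of "k * (x - a)"] smooth_step_bounds[of "k * (x - b)"]
  unfolding plateau_def by linarith

lemma plateau_eq_0: "k > 0 \<Longrightarrow> a \<le> b \<Longrightarrow> x \<le> a \<or> x \<ge> b + 2 / k \<Longrightarrow> plateau a b k x = 0"
proof -
  assume k: "k > 0" and ab: "a \<le> b" and "x \<le> a \<or> x \<ge> b + 2 / k"
  then consider "x \<le> a" | "x \<ge> b + 2 / k" by auto
  then show ?thesis
  proof cases
    case 1
    then show ?thesis unfolding plateau_def
      using k ab by (subst (1 2) smooth_step_eq_0) (auto simp: mult_le_0_iff)
  next
    case 2
    then have "2 \<le> k * (x - b)" using k by (simp add: field_simps)
    moreover have "k * (x - b) \<le> k * (x - a)" using k ab by simp
    ultimately show ?thesis unfolding plateau_def by (simp add: smooth_step_eq_1)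
  qed
qed

lemma test_functions_plateau:
  assumes "k > 0" "0 < a" "a \<le> b" "b + 2 / k < T"
  shows "plateau a b k \<in> test_functions {0<..<T}"
proof -
  have "x \<in> {a..b + 2/k}" if "plateau a b k x \<noteq> 0" for x
    using plateau_eq_0[OF assms(1,3), of x] that by (cases "x \<le> a"; cases "x \<ge> b + 2/k") auto
  then have sub: "closure {x. plateau a b k x \<noteq> 0} \<subseteq> {a..b + 2/k}"
    by (intro closure_minimal) auto
  moreover have "compact (closure {x. plateau a b k x \<noteq> 0})"
    using compact_Int_closed[OF compact_Icc closed_closure, of a "b + 2/k"] sub
    by (metis inf.absorb2)
  moreover have "plateau a b k C1_differentiable_on UNIV"
    unfolding C1_differentiable_on_def
    by (intro exI[of _ "\<lambda>x. k * tent (k * (x - a)) - k * tent (k * (x - b))"])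
       (auto intro!: continuous_intros DERIV_plateau simp flip: has_real_derivative_iff_has_vector_derivative)
  ultimately show ?thesis using assms by (force simp: test_functions_def)
qed

text \<open>The kernels are nonnegative, have unit mass by the fundamental theorem of calculus for
  \<open>smooth_step\<close>, and vanish outside an interval of length \<open>2 / n\<close> to the
  right of \<open>a\<close>.\<close>

lemma tent_approximate_identity:
  fixes u :: "real \<Rightarrow> real"
  assumes "continuous_on {0..T} u" "0 < a" "a < T"
  shows "(\<lambda>n. LINT x|leb T. u x * (real n * tent (real n * (x - a)))) \<longlonglongrightarrow> u a"
proof (rule LIMSEQ_I)
  fix e :: real assume e: "e > 0"
  have "continuous (at a within {0..T}) u" using assms by (simp add: continuous_on_eq_continuous_within)
  then obtain d where d: "d > 0" "\<And>x. x \<in> {0..T} \<Longrightarrow> \<bar>x - a\<bar> < d \<Longrightarrow> \<bar>u x - u a\<bar> < e / 2"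
    using e unfolding continuous_within_eps_delta dist_real_def by (meson half_gt_zero)
  \<comment> \<open>The first bound keeps the support within \<open>d\<close> of \<open>a\<close>;
    the second keeps it to the left of \<open>T\<close>, so that no mass is lost.\<close>
  obtain N :: nat where N: "real N > max (2 / d) (2 / (T - a))" using reals_Archimedean2 by blast
  have "norm ((LINT x|leb T. u x * (real n * tent (real n * (x - a)))) - u a) < e" if n: "n \<ge> N" for n
  proof -
    let ?K = "\<lambda>x. real n * tent (real n * (x - a))"
    have n2: "real n > 2 / d" "real n > 2 / (T - a)" using N n by auto
    have npos: "real n > 0" using n2 d by (smt (verit) divide_pos_pos)
    have nd: "2 < real n * d" "2 < real n * (T - a)" using n2 d assms by (auto simp: field_simps)
    have cK: "continuous_on {0..T} ?K" by (intro continuous_intros)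
    have iK: "integrable (leb T) ?K" by (rule integrable_leb_continuous[OF cK])
    have iuK: "integrable (leb T) (\<lambda>x. u x * ?K x)"
      by (intro integrable_leb_continuous continuous_intros assms)
    have DERIV_step: "((\<lambda>x. smooth_step (real n * (x - a))) has_real_derivative ?K x) (at x)" for x
    proof -
      have "((\<lambda>x. real n * (x - a)) has_real_derivative real n) (at x)" by (auto intro!: derivative_eq_intros)
      from DERIV_chain2[OF DERIV_smooth_step this] show ?thesis by (simp add: mult.commute)
    qed
    have "(?K has_integral (smooth_step (real n * (T - a)) - smooth_step (real n * (0 - a)))) {0..T}"
      by (rule fundamental_theorem_of_calculus)
         (use assms in \<open>auto intro!: DERIV_subset[OF DERIV_step]
            simp flip: has_real_derivative_iff_has_vector_derivative\<close>)
    moreover have "smooth_step (real n * (T - a)) = 1" using nd by (intro smooth_step_eq_1) auto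
    moreover have "smooth_step (real n * (0 - a)) = 0" using npos assms by (intro smooth_step_eq_0) auto
    ultimately have "(?K has_integral 1) {0..T}" by simp
    then have "integral {0..T} ?K = 1" by (rule integral_unique)
    then have one: "(LINT x|leb T. ?K x) = 1" using LINT_leb_eq_integral[OF iK] by simp
    have bound: "\<bar>(u x - u a) * ?K x\<bar> \<le> e / 2 * ?K x" if "x \<in> {0<..<T}" for x
    proof (cases "?K x = 0")
      case False
      then have "\<not> real n * (x - a) \<le> 0" "\<not> 2 \<le> real n * (x - a)" using tent_eq_0 by auto
      then have "0 < real n * (x - a)" "real n * (x - a) < 2" by linarith+
      then have "0 < x - a" using npos by (simp add: zero_less_mult_iff)
      have "real n * (x - a) < real n * d" using nd \<open>real n * (x - a) < 2\<close> by linarith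
      then have "x - a < d" using mult_less_cancel_left_pos[OF npos, of "x - a" d] by blast
      then have "\<bar>x - a\<bar> < d" using \<open>0 < x - a\<close> by simp
      then have "\<bar>u x - u a\<bar> \<le> e / 2" using d(2)[of x] that by force
      moreover have "?K x \<ge> 0" by (simp add: tent_nonneg)
      ultimately show ?thesis using mult_right_mono[of "\<bar>u x - u a\<bar>" "e / 2" "?K x"]
        by (simp only: abs_mult[of "u x - u a"] abs_of_nonneg)
    next
      case True
      show ?thesis unfolding True by simp
    qed
    have "(LINT x|leb T. u x * ?K x) - u a = (LINT x|leb T. u x * ?K x) - u a * (LINT x|leb T. ?K x)"
      by (simp only: one mult_1_right)
    also have "\<dots> = (LINT x|leb T. (u x - u a) * ?K x)"
      unfolding left_diff_distrib
      by (subst Bochner_Integration.integral_diff[OF iuK integrable_mult_right[OF iK]]) simp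
    also have "\<bar>\<dots>\<bar> \<le> (LINT x|leb T. e / 2 * ?K x)"
    proof (rule integral_abs_bound_integral)
      show "integrable (leb T) (\<lambda>x. (u x - u a) * ?K x)"
        by (intro integrable_leb_continuous continuous_intros assms)
      show "integrable (leb T) (\<lambda>x. e / 2 * ?K x)"
        by (intro integrable_leb_continuous continuous_intros)
    qed (use bound in simp)
    also have "\<dots> = e / 2" using one by (subst integral_mult_right_zero) simp
    finally show ?thesis using e by simp
  qed
  then show "\<exists>N. \<forall>n\<ge>N. norm ((LINT x|leb T. u x * (real n * tent (real n * (x - a)))) - u a) < e" by blast
qed

lemma plateau_tendsto: "a \<le> b \<Longrightarrow> (\<lambda>n. plateau a b (real n) x) \<longlonglongrightarrow> indicator {a<..b} x"
proof -
  have *: "(\<lambda>n. smooth_step (real n * (x - c))) \<longlonglongrightarrow> (if c < x then 1 else 0)" for c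
  proof (cases "c < x")
    case True
    obtain N :: nat where N: "real N > 2 / (x - c)" using reals_Archimedean2 by blast
    have "smooth_step (real n * (x - c)) = 1" if "n \<ge> N" for n
    proof (rule smooth_step_eq_1)
      have "2 / (x - c) \<le> real n" using N that by (meson less_imp_le of_nat_le_iff order_trans)
      then show "2 \<le> real n * (x - c)" using True by (simp add: field_simps)
    qed
    then show ?thesis using True by (intro tendsto_eventually eventually_sequentiallyI[of N]) simp
  next
    case False
    then have "smooth_step (real n * (x - c)) = 0" for n
      by (intro smooth_step_eq_0) (auto simp: mult_le_0_iff)
    then show ?thesis using False by simp
  qed
  assume "a \<le> b"
  then show ?thesis unfolding plateau_def using tendsto_diff[OF *[of a] *[of b]]
    by (auto simp: indicator_def split: if_splits)
qed

text \<open>The lemma of du Bois-Reymond, tested against smoothed indicators of \<open>{a<..b}\<close>.\<close>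

lemma weak_derivative_integral:
  fixes u g :: "real \<Rightarrow> real"
  assumes cont: "continuous_on {0..T} u" and g: "integrable (leb T) g"
    and weak: "\<And>\<phi>. \<phi> \<in> test_functions {0<..<T} \<Longrightarrow>
        (LINT x|leb T. u x * deriv \<phi> x) = - (LINT x|leb T. g x * \<phi> x)"
    and x: "x \<in> {0..T}"
  shows "u x = u 0 + integral {0..x} g"
proof -
  have abs_int: "g absolutely_integrable_on {0..T}" by (rule leb_integrable_imp_absolutely_integrable[OF g])
  then have int: "g integrable_on {0..T}" by (simp add: absolutely_integrable_on_def)
  \<comment> \<open>Interior points only: the plateau between \<open>a\<close> and \<open>b\<close>
    must have compact support in the open interval.\<close>
  have inner: "u b - u a = integral {a..b} g" if ab: "0 < a" "a \<le> b" "b < T" for a b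
  proof -
    have "(\<lambda>n. LINT x|leb T. plateau a b (real n) x * g x) \<longlonglongrightarrow> (LINT x|leb T. indicator {a<..b} x * g x)"
    proof (rule integral_dominated_convergence[where w = "\<lambda>x. \<bar>g x\<bar>"])
      show "AE x in leb T. (\<lambda>n. plateau a b (real n) x * g x) \<longlonglongrightarrow> indicator {a<..b} x * g x"
        using plateau_tendsto[OF ab(2)] by (intro AE_I2 tendsto_mult) auto
      show "AE x in leb T. norm (plateau a b (real n) x * g x) \<le> \<bar>g x\<bar>" for n
        using plateau_le_1 by (intro AE_I2) (simp add: abs_mult mult_left_le_one_le)
      show "(\<lambda>x. plateau a b (real n) x * g x) \<in> borel_measurable (leb T)" for n
        using g by (intro borel_measurable_times borel_measurable_integrable[OF g]
            borel_measurable_leb_continuous continuous_intros)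
      show "(\<lambda>x. indicat_real {a<..b} x * g x) \<in> borel_measurable (leb T)"
        by (rule borel_measurable_integrable[OF integrable_indicator_mult[OF g]])
    qed (use g in auto)
    then have lim1: "(\<lambda>n. LINT x|leb T. plateau a b (real n) x * g x) \<longlonglongrightarrow> integral {a..b} g"
      using LINT_leb_indicator[OF g, of a b] ab by simp
    \<comment> \<open>The derivative of a plateau is the difference of these kernels at
      \<open>a\<close> and \<open>b\<close>, so the weak identity recovers the two point values of
      \<open>u\<close> in the limit.\<close>
    let ?K = "\<lambda>c n x. real n * tent (real n * (x - c))"
    have lim2: "(\<lambda>n. (LINT x|leb T. u x * ?K a n x) - (LINT x|leb T. u x * ?K b n x)) \<longlonglongrightarrow> u a - u b"
      using ab by (intro tendsto_diff tent_approximate_identity cont) auto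
    \<comment> \<open>Beyond this \<open>N\<close> the right ramp of the plateau ends before
      \<open>T\<close>.\<close>
    obtain N :: nat where N: "real N > 2 / (T - b)" using reals_Archimedean2 by blast
    have ev: "(LINT x|leb T. u x * ?K a n x) - (LINT x|leb T. u x * ?K b n x)
            = - (LINT x|leb T. plateau a b (real n) x * g x)" if n: "n \<ge> N" for n
    proof -
      have n2: "2 / (T - b) < real n" using N n by (meson less_le_trans of_nat_le_iff)
      then have np: "real n > 0" using ab by (smt (verit) divide_pos_pos)
      have "b + 2 / real n < T" using n2 np ab by (simp add: field_simps)
      then have mem: "plateau a b (real n) \<in> test_functions {0<..<T}"
        using ab np by (intro test_functions_plateau) auto
      have "(LINT x|leb T. u x * ?K a n x) - (LINT x|leb T. u x * ?K b n x)
          = (LINT x|leb T. u x * ?K a n x - u x * ?K b n x)"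
        by (rule Bochner_Integration.integral_diff[symmetric])
           (intro integrable_leb_continuous continuous_intros cont)+
      also have "\<dots> = (LINT x|leb T. u x * deriv (plateau a b (real n)) x)"
        by (simp only: DERIV_imp_deriv[OF DERIV_plateau] right_diff_distrib[of "u _"])
      finally show ?thesis unfolding weak[OF mem] by (simp only: mult.commute)
    qed
    have "(\<lambda>n. - (LINT x|leb T. plateau a b (real n) x * g x)) \<longlonglongrightarrow> u a - u b"
      by (rule Lim_transform_eventually[OF lim2]) (use ev in \<open>auto simp: eventually_sequentially\<close>)
    from LIMSEQ_unique[OF this tendsto_minus[OF lim1]] show ?thesis by simp
  qed
  show ?thesis
  proof (cases "T > 0")
    case False
    then have "x = 0" using x by simp
    then show ?thesis by simp
  next
    case True
    \<comment> \<open>By the claim just shown \<open>f\<close> is constant in the interior;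
      continuity carries this to both endpoints.\<close>
    define f where "f = (\<lambda>x. u x - integral {0..x} g)"
    have "continuous_on {0..T} f"
      unfolding f_def by (intro continuous_on_diff cont indefinite_integral_continuous_1 int)
    then have cf: "continuous_on (closure {0<..<T}) f"
      using True by (simp add: closure_greaterThanLessThan)
    have step: "f b = f a" if "0 < a" "a \<le> b" "b < T" for a b
    proof -
      have "g integrable_on {0..b}" by (rule integrable_subinterval_real[OF int]) (use that in auto)
      then have "integral {0..a} g + integral {a..b} g = integral {0..b} g"
        using that by (intro Henstock_Kurzweil_Integration.integral_combine) auto
      then show ?thesis using inner[OF that] by (simp add: f_def)
    qed
    have "f y = f (T/2)" if "y \<in> {0<..<T}" for y
      using step[of y "T/2"] step[of "T/2" y] that True by (cases "y \<le> T/2") auto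
    then have "f y = f (T/2)" if "y \<in> closure {0<..<T}" for y
      by (rule continuous_constant_on_closure[OF cf _ that])
    moreover have "x \<in> closure {0<..<T}" "0 \<in> closure {0<..<T}"
      using x True by (simp_all add: closure_greaterThanLessThan)
    ultimately have "f x = f 0" by metis
    then show ?thesis by (simp add: f_def)
  qed
qed

section \<open>Periodic Sobolev functions\<close>

text \<open>The weak derivative is kept explicit, so that combinations and limits act on both
  components and the energy is a function of the pair.\<close>

definition periodic_pair :: "real \<Rightarrow> real \<Rightarrow> (real \<Rightarrow> real) \<Rightarrow> (real \<Rightarrow> real) \<Rightarrow> bool" where
  "periodic_pair T p u g \<longleftrightarrow>
     has_weak_Lp_derivative u g p {0<..<T} \<and> continuous_on {0..T} u \<and> u 0 = u T"

definition energy :: "real \<Rightarrow> (real \<Rightarrow> real) \<Rightarrow> real \<Rightarrow> (real \<Rightarrow> real) \<Rightarrow> (real \<Rightarrow> real) \<Rightarrow> real" where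
  "energy T q p u g = (LINT x|leb T. \<bar>g x\<bar> powr p + q x * \<bar>u x\<bar> powr p)"

definition mass :: "real \<Rightarrow> (real \<Rightarrow> real) \<Rightarrow> real \<Rightarrow> (real \<Rightarrow> real) \<Rightarrow> real" where
  "mass T w p u = (LINT x|leb T. w x * \<bar>u x\<bar> powr p)"

lemma constrained_energies_eq:
  "constrained_energies T q w p = {energy T q p u g | u g. periodic_pair T p u g \<and> mass T w p u = 1}"
  unfolding constrained_energies_def energy_def mass_def periodic_pair_def
    sobolev1_periodic_def sobolev1_def by blast

lemma integrable_powr_mono:
  fixes g :: "real \<Rightarrow> real"
  assumes "g \<in> borel_measurable (leb T)" "integrable (leb T) (\<lambda>x. \<bar>g x\<bar> powr p')" "0 < p" "p \<le> p'"
  shows "integrable (leb T) (\<lambda>x. \<bar>g x\<bar> powr p)"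
proof (rule Bochner_Integration.integrable_bound[where f = "\<lambda>x. \<bar>g x\<bar> powr p' + (1 - p/p')"])
  show "AE x in leb T. norm (\<bar>g x\<bar> powr p) \<le> norm (\<bar>g x\<bar> powr p' + (1 - p/p'))"
  proof (rule AE_I2)
    fix x
    have "\<bar>g x\<bar> powr p \<le> \<bar>g x\<bar> powr p' + (1 - p/p')" by (rule powr_le_powr_add[OF assms(3,4)])
    then show "norm (\<bar>g x\<bar> powr p) \<le> norm (\<bar>g x\<bar> powr p' + (1 - p/p'))" by simp
  qed
  show "integrable (leb T) (\<lambda>x. \<bar>g x\<bar> powr p' + (1 - p/p'))"
    by (intro Bochner_Integration.integrable_add assms integrable_const_leb)
qed (use assms in measurable)

lemma integrable_of_powr:
  fixes g :: "real \<Rightarrow> real"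
  assumes "g \<in> borel_measurable (leb T)" "integrable (leb T) (\<lambda>x. \<bar>g x\<bar> powr p)" "1 \<le> p"
  shows "integrable (leb T) g"
proof -
  have "integrable (leb T) (\<lambda>x. \<bar>g x\<bar> powr 1)"
    by (rule integrable_powr_mono[OF assms(1,2)]) (use assms in auto)
  then show ?thesis using integrable_abs_iff[OF assms(1)] by simp
qed

lemma powr_add_le: "p \<ge> 0 \<Longrightarrow> \<bar>a + b\<bar> powr p \<le> 2 powr p * (\<bar>a\<bar> powr p + \<bar>b\<bar> powr p)"
  for a b p :: real
proof -
  assume p: "p \<ge> 0"
  have "\<bar>a + b\<bar> powr p \<le> (2 * max \<bar>a\<bar> \<bar>b\<bar>) powr p" using p by (intro powr_mono2) auto
  also have "\<dots> = 2 powr p * max \<bar>a\<bar> \<bar>b\<bar> powr p" by (simp add: powr_mult)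
  also have "\<dots> \<le> 2 powr p * (\<bar>a\<bar> powr p + \<bar>b\<bar> powr p)" by (intro mult_left_mono) (auto simp: max_def)
  finally show ?thesis .
qed

lemma integrable_powr_add:
  fixes f g :: "real \<Rightarrow> real"
  assumes "f \<in> borel_measurable M" "g \<in> borel_measurable M" "p \<ge> 0"
    "integrable M (\<lambda>x. \<bar>f x\<bar> powr p)" "integrable M (\<lambda>x. \<bar>g x\<bar> powr p)"
  shows "integrable M (\<lambda>x. \<bar>f x + g x\<bar> powr p)"
proof (rule Bochner_Integration.integrable_bound[where f = "\<lambda>x. 2 powr p * (\<bar>f x\<bar> powr p + \<bar>g x\<bar> powr p)"])
  show "AE x in M. norm (\<bar>f x + g x\<bar> powr p) \<le> norm (2 powr p * (\<bar>f x\<bar> powr p + \<bar>g x\<bar> powr p))"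
  proof (rule AE_I2)
    fix x
    show "norm (\<bar>f x + g x\<bar> powr p) \<le> norm (2 powr p * (\<bar>f x\<bar> powr p + \<bar>g x\<bar> powr p))"
      using powr_add_le[OF assms(3), of "f x" "g x"] by simp
  qed
qed (use assms in auto)

lemma integrable_powr_cmult:
  fixes f :: "real \<Rightarrow> real"
  assumes "integrable M (\<lambda>x. \<bar>f x\<bar> powr p)"
  shows "integrable M (\<lambda>x. \<bar>c * f x\<bar> powr p)"
  using assms by (simp add: abs_mult powr_mult)

lemma test_functionsD:
  assumes "\<phi> \<in> test_functions {0<..<T}"
  shows "continuous_on A \<phi>" "continuous_on A (deriv \<phi>)" "(\<phi> has_real_derivative deriv \<phi> x) (at x)"
    "\<phi> 0 = 0" "\<phi> T = 0"
proof -
  obtain D where D: "\<And>x. (\<phi> has_real_derivative D x) (at x)" "continuous_on UNIV D"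
    using assms unfolding test_functions_def C1_differentiable_on_def
    by (auto simp: has_real_derivative_iff_has_vector_derivative)
  have [simp]: "deriv \<phi> = D" using D(1) by (auto intro: DERIV_imp_deriv)
  show "continuous_on A \<phi>" using D(1) by (intro DERIV_continuous_on) (blast intro: DERIV_subset)
  show "continuous_on A (deriv \<phi>)" using D(2) by (auto intro: continuous_on_subset)
  show "(\<phi> has_real_derivative deriv \<phi> x) (at x)" using D(1) by simp
  have "closure {x. \<phi> x \<noteq> 0} \<subseteq> {0<..<T}" using assms by (simp add: test_functions_def)
  then have "{x. \<phi> x \<noteq> 0} \<subseteq> {0<..<T}" by (rule order_trans[OF closure_subset])
  then show "\<phi> 0 = 0" "\<phi> T = 0" by auto
qed

lemma periodic_pairD:
  assumes "periodic_pair T p u g"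
  shows "continuous_on {0..T} u" "u 0 = u T" "u \<in> borel_measurable (leb T)" "g \<in> borel_measurable (leb T)"
    "integrable (leb T) (\<lambda>x. \<bar>g x\<bar> powr p)"
    "\<phi> \<in> test_functions {0<..<T} \<Longrightarrow>
      (LINT x|leb T. u x * deriv \<phi> x) = - (LINT x|leb T. g x * \<phi> x)"
  using assms by (auto simp: periodic_pair_def has_weak_Lp_derivative_def Lp_on_def)

lemma periodic_pair_integrable:
  assumes "periodic_pair T p u g" "1 \<le> p"
  shows "integrable (leb T) g"
  using integrable_of_powr periodic_pairD(4,5)[OF assms(1)] assms(2) by blast

lemma continuous_weighted_powr:
  fixes u w :: "'a::t2_space \<Rightarrow> real"
  assumes "continuous_on A w" "continuous_on A u" "0 < p"
  shows "continuous_on A (\<lambda>x. w x * \<bar>u x\<bar> powr p)"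
  by (intro continuous_on_mult continuous_on_powr' continuous_on_rabs continuous_on_const assms)
     (use assms in auto)

lemma integrable_weighted_powr:
  fixes u w :: "real \<Rightarrow> real"
  assumes "continuous_on {0..T} w" "continuous_on {0..T} u" "0 < p"
  shows "integrable (leb T) (\<lambda>x. w x * \<bar>u x\<bar> powr p)"
  by (rule integrable_leb_continuous[OF continuous_weighted_powr[OF assms]])

lemma integrable_powr_continuous:
  fixes u :: "real \<Rightarrow> real"
  assumes "continuous_on {0..T} u" "0 < p"
  shows "integrable (leb T) (\<lambda>x. \<bar>u x\<bar> powr p)"
  using integrable_weighted_powr[of T "\<lambda>_. 1" u p] assms by simp

lemma periodic_pairI:
  assumes "continuous_on {0..T} u" "u 0 = u T" "g \<in> borel_measurable (leb T)" "0 < p"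
    "integrable (leb T) (\<lambda>x. \<bar>g x\<bar> powr p)"
    "\<And>\<phi>. \<phi> \<in> test_functions {0<..<T} \<Longrightarrow>
      (LINT x|leb T. u x * deriv \<phi> x) = - (LINT x|leb T. g x * \<phi> x)"
  shows "periodic_pair T p u g"
  using assms integrable_powr_continuous[of T u p] borel_measurable_leb_continuous[of T u]
  by (auto simp: periodic_pair_def has_weak_Lp_derivative_def Lp_on_def)

lemma periodic_pair_mono:
  assumes "periodic_pair T p' u g" "0 < p" "p \<le> p'"
  shows "periodic_pair T p u g"
  using periodic_pairD[OF assms(1)] assms(2,3)
  by (intro periodic_pairI integrable_powr_mono[of g T p' p]) auto

text \<open>Normalisation uses the case \<open>b = 0\<close>, the midpoint of two competitors the
  case \<open>a = b = 1/2\<close>.\<close>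

lemma periodic_pair_combine:
  assumes "periodic_pair T p u g" "periodic_pair T p v h" "1 \<le> p"
  shows "periodic_pair T p (\<lambda>x. a * u x + b * v x) (\<lambda>x. a * g x + b * h x)"
proof (rule periodic_pairI)
  note [measurable] = periodic_pairD(3,4)[OF assms(1)] periodic_pairD(3,4)[OF assms(2)]
  show "continuous_on {0..T} (\<lambda>x. a * u x + b * v x)"
    by (intro continuous_intros periodic_pairD[OF assms(1)] periodic_pairD[OF assms(2)])
  show "a * u 0 + b * v 0 = a * u T + b * v T"
    using periodic_pairD(2)[OF assms(1)] periodic_pairD(2)[OF assms(2)] by simp
  show "(\<lambda>x. a * g x + b * h x) \<in> borel_measurable (leb T)" by measurable
  show "integrable (leb T) (\<lambda>x. \<bar>a * g x + b * h x\<bar> powr p)"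
    using assms(3)
    by (intro integrable_powr_add integrable_powr_cmult periodic_pairD(5)[OF assms(1)]
        periodic_pairD(5)[OF assms(2)]) auto
  fix \<phi> assume phi: "\<phi> \<in> test_functions {0<..<T}"
  obtain B where B: "\<And>x. x \<in> {0..T} \<Longrightarrow> \<bar>\<phi> x\<bar> \<le> B"
    using continuous_bounded_Icc[OF test_functionsD(1)[OF phi]] by metis
  have ig: "integrable (leb T) (\<lambda>x. f x * \<phi> x)" if "integrable (leb T) f" for f
    using integrable_leb_mult_bounded[OF that, of \<phi> B] B
      borel_measurable_leb_continuous[OF test_functionsD(1)[OF phi]] by (simp add: mult.commute)
  have iu: "integrable (leb T) (\<lambda>x. f x * deriv \<phi> x)" if "continuous_on {0..T} f" for f
    by (intro integrable_leb_continuous continuous_intros that test_functionsD(2)[OF phi])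
  note iu = iu[OF periodic_pairD(1)[OF assms(1)]] iu[OF periodic_pairD(1)[OF assms(2)]]
    and ig = ig[OF periodic_pair_integrable[OF assms(1,3)]] ig[OF periodic_pair_integrable[OF assms(2,3)]]
  have "(LINT x|leb T. (a * u x + b * v x) * deriv \<phi> x)
      = a * (LINT x|leb T. u x * deriv \<phi> x) + b * (LINT x|leb T. v x * deriv \<phi> x)"
    using iu by (simp add: distrib_right mult.assoc)
  also have "\<dots> = - (LINT x|leb T. (a * g x + b * h x) * \<phi> x)"
    using ig by (simp add: distrib_right mult.assoc periodic_pairD(6)[OF assms(1) phi]
        periodic_pairD(6)[OF assms(2) phi])
  finally show "(LINT x|leb T. (a * u x + b * v x) * deriv \<phi> x) = - (LINT x|leb T. (a * g x + b * h x) * \<phi> x)" .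
qed (use assms in simp)

text \<open>Integration by parts; the boundary terms vanish with the test function. Since
  \<open>h\<close> is continuous, the pair is admissible for every positive exponent at
  once.\<close>

lemma periodic_pair_continuous:
  assumes "T > 0" "continuous_on {0..T} h" "\<And>x. x \<in> {0..T} \<Longrightarrow> v x = c + integral {0..x} h" "v 0 = v T" "0 < p"
  shows "periodic_pair T p v h"
proof (rule periodic_pairI)
  have "((\<lambda>x. integral {0..x} h) has_real_derivative h x) (at x within {0..T})" if "x \<in> {0..T}" for x
    by (rule integral_has_real_derivative[OF assms(2) that])
  then have "((\<lambda>x. c + integral {0..x} h) has_real_derivative h x) (at x within {0..T})" if "x \<in> {0..T}" for x
    using that by (auto intro!: derivative_eq_intros)
  then have dv: "(v has_real_derivative h x) (at x within {0..T})" if "x \<in> {0..T}" for x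
    by (rule has_field_derivative_transform_within[where d = 1 and f = "\<lambda>x. c + integral {0..x} h"])
       (use that assms(3) in auto)
  then show cv: "continuous_on {0..T} v" by (intro DERIV_continuous_on)
  show "h \<in> borel_measurable (leb T)" by (rule borel_measurable_leb_continuous) fact
  show "integrable (leb T) (\<lambda>x. \<bar>h x\<bar> powr p)" by (rule integrable_powr_continuous) fact+
  fix \<phi> assume phi: "\<phi> \<in> test_functions {0<..<T}"
  note c = cv assms(2) test_functionsD(1,2)[OF phi]
  have i: "integrable (leb T) (\<lambda>x. v x * deriv \<phi> x)" "integrable (leb T) (\<lambda>x. h x * \<phi> x)"
    by (intro integrable_leb_continuous continuous_intros c)+
  have "((\<lambda>x. v x * \<phi> x) has_vector_derivative v x * deriv \<phi> x + h x * \<phi> x) (at x within {0..T})"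
    if "x \<in> {0..T}" for x
    using DERIV_mult'[OF dv[OF that] DERIV_subset[OF test_functionsD(3)[OF phi] subset_UNIV]]
    by (simp add: has_real_derivative_iff_has_vector_derivative)
  then have "((\<lambda>x. v x * deriv \<phi> x + h x * \<phi> x) has_integral v T * \<phi> T - v 0 * \<phi> 0) {0..T}"
    using assms(1) by (intro fundamental_theorem_of_calculus) auto
  then have "integral {0..T} (\<lambda>x. v x * deriv \<phi> x + h x * \<phi> x) = v T * \<phi> T - v 0 * \<phi> 0"
    by (rule integral_unique)
  then have "integral {0..T} (\<lambda>x. v x * deriv \<phi> x + h x * \<phi> x) = 0"
    by (simp add: test_functionsD(4,5)[OF phi])
  moreover have "integrable (leb T) (\<lambda>x. v x * deriv \<phi> x + h x * \<phi> x)" using i by simp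
  ultimately have "(LINT x|leb T. v x * deriv \<phi> x + h x * \<phi> x) = 0"
    by (simp only: LINT_leb_eq_integral)
  then show "(LINT x|leb T. v x * deriv \<phi> x) = - (LINT x|leb T. h x * \<phi> x)"
    using i by simp
qed (use assms in auto)

lemma periodic_pair_integral:
  assumes "periodic_pair T p u g" "1 \<le> p" "x \<in> {0..T}"
  shows "u x = u 0 + integral {0..x} g"
  by (rule weak_derivative_integral[OF periodic_pairD(1)[OF assms(1)] periodic_pair_integrable[OF assms(1,2)] _ assms(3)])
     (rule periodic_pairD(6)[OF assms(1)])

section \<open>Rayleigh quotients and competitors\<close>

lemma energy_split:
  assumes "integrable (leb T) (\<lambda>x. \<bar>g x\<bar> powr p)" "continuous_on {0..T} q" "continuous_on {0..T} u" "0 < p"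
  shows "energy T q p u g = (LINT x|leb T. \<bar>g x\<bar> powr p) + mass T q p u"
  unfolding energy_def mass_def
  by (rule Bochner_Integration.integral_add[OF assms(1) integrable_weighted_powr[OF assms(2,3,4)]])

lemma mass_nonneg:
  assumes "\<forall>x\<in>{0..T}. w x \<ge> 0"
  shows "mass T w p u \<ge> 0"
  unfolding mass_def using assms by (intro Bochner_Integration.integral_nonneg) auto

lemma energy_nonneg:
  assumes "\<forall>x\<in>{0..T}. q x \<ge> 0"
  shows "energy T q p u g \<ge> 0"
  unfolding energy_def using assms by (intro Bochner_Integration.integral_nonneg) auto

lemma mass_scale: "mass T w p (\<lambda>x. c * u x) = \<bar>c\<bar> powr p * mass T w p u"
proof -
  have "w x * \<bar>c * u x\<bar> powr p = \<bar>c\<bar> powr p * (w x * \<bar>u x\<bar> powr p)" for x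
    by (simp add: abs_mult powr_mult)
  then show ?thesis unfolding mass_def by (simp only: integral_mult_right_zero)
qed

lemma energy_scale: "energy T q p (\<lambda>x. c * u x) (\<lambda>x. c * g x) = \<bar>c\<bar> powr p * energy T q p u g"
proof -
  have "\<bar>c * g x\<bar> powr p + q x * \<bar>c * u x\<bar> powr p = \<bar>c\<bar> powr p * (\<bar>g x\<bar> powr p + q x * \<bar>u x\<bar> powr p)" for x
    by (simp add: abs_mult powr_mult distrib_left mult.left_commute)
  then show ?thesis unfolding energy_def by (simp only: integral_mult_right_zero)
qed

text \<open>Energy and mass are both homogeneous of degree \<open>p\<close>, so a competitor of
  positive mass can be normalised without changing their quotient.\<close>

lemma energy_div_mass_mem:
  assumes W: "periodic_pair T p u g" and p: "1 \<le> p" and m: "mass T w p u > 0"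
  shows "energy T q p u g / mass T w p u \<in> constrained_energies T q w p"
proof -
  define c where "c = mass T w p u powr (- 1 / p)"
  have "\<bar>c\<bar> powr p = mass T w p u powr (-1)" using p by (simp add: c_def powr_powr)
  then have c: "\<bar>c\<bar> powr p = 1 / mass T w p u" using m by (simp add: powr_minus_divide)
  have "periodic_pair T p (\<lambda>x. c * u x) (\<lambda>x. c * g x)"
    using periodic_pair_combine[OF W W p, of c 0] by simp
  moreover have "mass T w p (\<lambda>x. c * u x) = 1" using c m by (simp add: mass_scale)
  moreover have "energy T q p (\<lambda>x. c * u x) (\<lambda>x. c * g x) = energy T q p u g / mass T w p u"
    using c by (simp add: energy_scale)
  ultimately show ?thesis unfolding constrained_energies_eq by (metis (mono_tags, lifting) mem_Collect_eq)
qed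

lemma constrained_energies_nonneg:
  assumes "\<forall>x\<in>{0..T}. q x \<ge> 0" "E \<in> constrained_energies T q w p"
  shows "E \<ge> 0"
  using assms(2) energy_nonneg[OF assms(1)] unfolding constrained_energies_eq by auto

lemma lambda_plus_lower:
  assumes "\<forall>x\<in>{0..T}. q x \<ge> 0" "E \<in> constrained_energies T q w p"
  shows "lambda_plus T q w p \<le> E"
  unfolding lambda_plus_def
  by (rule cInf_lower[OF assms(2)]) (use constrained_energies_nonneg[OF assms(1)] in \<open>auto simp: bdd_below_def\<close>)

lemma lambda_plus_le:
  assumes q: "\<forall>x\<in>{0..T}. q x \<ge> 0" and W: "periodic_pair T p u g" and p: "1 \<le> p" and m: "mass T w p u > 0"
  shows "lambda_plus T q w p \<le> energy T q p u g / mass T w p u"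
  by (rule lambda_plus_lower[OF q energy_div_mass_mem[OF W p m]])

text \<open>The bump is a plateau supported where the weight is positive.\<close>

lemma constrained_energies_nonempty:
  assumes T: "T > 0" and w: "continuous_on {0..T} w" "\<exists>x\<in>{0..T}. w x > 0" and p: "1 \<le> p"
  shows "constrained_energies T q w p \<noteq> {}"
proof -
  obtain x0 where x0: "x0 \<in> {0..T}" "w x0 > 0" using w(2) by blast
  have "continuous (at x0 within {0..T}) w" using w(1) x0 by (simp add: continuous_on_eq_continuous_within)
  then obtain d where d: "d > 0" "\<And>x. x \<in> {0..T} \<Longrightarrow> \<bar>x - x0\<bar> < d \<Longrightarrow> \<bar>w x - w x0\<bar> < w x0"
    using x0(2) unfolding continuous_within_eps_delta dist_real_def by meson
  \<comment> \<open>An interval of length \<open>l\<close> with \<open>x0\<close> as one endpoint,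
    extending towards the farther end of the domain, stays in the domain and within \<open>d\<close>
    of \<open>x0\<close>.\<close>
  define l where "l = min (d/2) (T/2)"
  obtain a where a: "{a..a+l} \<subseteq> {0..T}" "{a..a+l} \<subseteq> {x0 - l..x0 + l}" 
  proof (cases "x0 \<le> T/2")
    case True then show ?thesis using that[of x0] x0(1) by (auto simp: l_def min_def split: if_splits)
  next
    case False then show ?thesis using that[of "x0 - l"] x0(1) by (auto simp: l_def min_def split: if_splits)
  qed
  have l: "l > 0" using d T by (simp add: l_def)
  have wpos: "w x > 0" if "x \<in> {a..a+l}" for x
  proof -
    have "\<bar>x - x0\<bar> < d" using a(2) that d(1) by (force simp: l_def abs_le_iff min_def split: if_splits)
    then show ?thesis using d(2)[of x] a(1) that by force
  qed
  \<comment> \<open>With steepness \<open>5 / l\<close> each ramp has width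
    \<open>2 * l / 5\<close>, so the support, from \<open>a + l/5\<close> to
    \<open>a + 4*l/5\<close>, lies strictly inside the interval and \<open>v\<close> vanishes at 0
    and \<open>T\<close>.\<close>
  define v where "v = plateau (a + l/5) (a + 2*l/5) (5 / l)"
  define h where "h = (\<lambda>x. 5 / l * tent (5 / l * (x - (a + l/5))) - 5 / l * tent (5 / l * (x - (a + 2*l/5))))"
  have v0: "v x = 0" if "x \<le> a + l/5 \<or> x \<ge> a + 4*l/5" for x
    unfolding v_def using that l by (intro plateau_eq_0) (auto simp: field_simps)
  have a0: "0 \<le> a" "a + l \<le> T" using a(1) l by (auto simp: subset_iff)
  have ch: "continuous_on A h" for A unfolding h_def by (intro continuous_intros)
  have W: "periodic_pair T p v h"
  proof (rule periodic_pair_continuous[where c = "v 0"])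
    show "v 0 = v T" using v0[of 0] v0[of T] a0 l by simp
    fix x assume x: "x \<in> {0..T}"
    have "(v has_real_derivative h y) (at y within A)" for y A
      unfolding h_def v_def by (rule DERIV_subset[OF DERIV_plateau]) simp
    then have "(h has_integral v x - v 0) {0..x}"
      using x by (intro fundamental_theorem_of_calculus)
         (simp_all flip: has_real_derivative_iff_has_vector_derivative)
    then show "v x = v 0 + integral {0..x} h" by (simp add: integral_unique)
  qed (use T p ch in auto)
  have cv: "continuous_on {0..T} v" using W by (rule periodic_pairD)
  have vnn: "v x \<ge> 0" for x unfolding v_def using l by (intro plateau_nonneg) auto
  have nn: "w x * \<bar>v x\<bar> powr p \<ge> 0" for x
    using wpos[of x] v0[of x] l by (cases "x \<in> {a..a+l}") (auto simp: less_imp_le)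
  have "mass T w p v \<noteq> 0"
  proof
    assume "mass T w p v = 0"
    moreover have int: "integrable (leb T) (\<lambda>x. w x * \<bar>v x\<bar> powr p)"
      using integrable_weighted_powr w(1) cv p by auto
    ultimately have "integral {0..T} (\<lambda>x. w x * \<bar>v x\<bar> powr p) = 0"
      using LINT_leb_eq_integral[OF int] by (simp add: mass_def)
    moreover have "continuous_on {0..T} (\<lambda>x. w x * \<bar>v x\<bar> powr p)"
        using w(1) cv p by (intro continuous_weighted_powr) auto
    ultimately have "\<forall>x\<in>{0..T}. w x * \<bar>v x\<bar> powr p = 0"
      using integral_eq_0_iff[of 0 T "\<lambda>x. w x * \<bar>v x\<bar> powr p"] nn T by auto
    moreover have "a + 2*l/5 \<in> {0..T}" "a + 2*l/5 \<in> {a..a+l}" using a0 l by auto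
    \<comment> \<open>The foot of the second ramp: the first step has the value
      \<open>smooth_step 1 > 0\<close> there, while the second is still 0.\<close>
    moreover have "v (a + 2*l/5) > 0"
      unfolding v_def plateau_def using l smooth_step_eq_0[of 0] smooth_step_pos by simp
    ultimately have "w (a + 2*l/5) > 0" "v (a + 2*l/5) > 0" "w (a + 2*l/5) * \<bar>v (a + 2*l/5)\<bar> powr p = 0"
      using wpos by blast+
    then show False by simp
  qed
  moreover have "mass T w p v \<ge> 0" unfolding mass_def using nn by (intro Bochner_Integration.integral_nonneg)
  ultimately have m: "mass T w p v > 0" by simp
  show ?thesis using energy_div_mass_mem[OF W p m] by blast
qed

section \<open>Upper semicontinuity\<close>

text \<open>Dominated convergence with function and exponent varying together. The base
  \<open>max 1 B\<close> makes the power monotone in the exponent, so a bound \<open>P\<close> on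
  the exponents yields a constant dominating function.\<close>

lemma LINT_powr_tendsto:
  fixes f :: "nat \<Rightarrow> real \<Rightarrow> real" and a h :: "real \<Rightarrow> real"
  assumes a: "continuous_on {0..T} a"
    and f: "\<And>n. f n \<in> borel_measurable (leb T)" "\<And>n x. x \<in> {0<..<T} \<Longrightarrow> \<bar>f n x\<bar> \<le> B"
    and h: "h \<in> borel_measurable (leb T)" "AE x in leb T. (\<lambda>n. f n x) \<longlonglongrightarrow> h x"
    and p: "p \<longlonglongrightarrow> p0" "p0 > 0" "\<And>n. p n > 0"
  shows "(\<lambda>n. LINT x|leb T. a x * \<bar>f n x\<bar> powr p n) \<longlonglongrightarrow> (LINT x|leb T. a x * \<bar>h x\<bar> powr p0)"
proof -
  note [measurable] = f(1) h(1) borel_measurable_leb_continuous[OF a]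
  obtain A where A: "A \<ge> 1" "\<And>x. x \<in> {0..T} \<Longrightarrow> \<bar>a x\<bar> \<le> A" using continuous_bounded_Icc[OF a] by metis
  obtain P where P: "\<And>n. p n \<le> P"
    using Bseq_eq_bounded convergent_imp_Bseq p(1) by (metis Bseq_def convergentI abs_le_D1 real_norm_def)
  show ?thesis
  proof (rule integral_dominated_convergence[where w = "\<lambda>x. A * max 1 B powr P"])
    show "AE x in leb T. norm (a x * \<bar>f n x\<bar> powr p n) \<le> A * max 1 B powr P" for n
    proof (rule AE_I2)
      fix x assume "x \<in> space (leb T)"
      then have x: "x \<in> {0<..<T}" by simp
      have "\<bar>f n x\<bar> powr p n \<le> max 1 B powr p n"
        using f(2)[OF x, of n] p(3)[of n] by (intro powr_mono2) auto
      also have "\<dots> \<le> max 1 B powr P" using P by (intro powr_mono) auto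
      finally show "norm (a x * \<bar>f n x\<bar> powr p n) \<le> A * max 1 B powr P"
        using A(1) A(2)[of x] x by (simp add: abs_mult mult_mono)
    qed
    show "AE x in leb T. (\<lambda>n. a x * \<bar>f n x\<bar> powr p n) \<longlonglongrightarrow> a x * \<bar>h x\<bar> powr p0"
      using h(2) by eventually_elim (intro tendsto_intros p, use p in auto)
  qed (auto intro: integrable_const_leb)
qed

lemma mass_tendsto:
  assumes "continuous_on {0..T} w" "\<And>n. continuous_on {0..T} (u n)" "continuous_on {0..T} v"
    "\<And>n x. x \<in> {0..T} \<Longrightarrow> \<bar>u n x\<bar> \<le> B" "\<And>x. x \<in> {0..T} \<Longrightarrow> (\<lambda>n. u n x) \<longlonglongrightarrow> v x"
    "p \<longlonglongrightarrow> p0" "p0 > 0" "\<And>n. p n > 0"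
  shows "(\<lambda>n. mass T w (p n) (u n)) \<longlonglongrightarrow> mass T w p0 v"
  unfolding mass_def
  by (rule LINT_powr_tendsto[where B = B])
     (use assms in \<open>auto intro!: AE_I2 borel_measurable_leb_continuous\<close>)

section \<open>Density of continuous derivatives among periodic functions\<close>

definition primitive :: "real \<Rightarrow> real \<Rightarrow> (real \<Rightarrow> real) \<Rightarrow> real \<Rightarrow> real" where
  "primitive T c g x = c + integral {0..x} g - x * (integral {0..T} g / T)"

text \<open>The derivative of \<open>primitive\<close>. Truncation and approximation destroy the
  zero mean that periodicity imposes on a derivative. Subtracting the mean restores it, and changes
  nothing for a function whose mean is already zero.\<close>

definition centered :: "real \<Rightarrow> (real \<Rightarrow> real) \<Rightarrow> real \<Rightarrow> real" where
  "centered T g x = g x - integral {0..T} g / T"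

lemma continuous_primitive:
  assumes "integrable (leb T) g"
  shows "continuous_on {0..T} (primitive T c g)"
proof -
  have "g integrable_on {0..T}"
    using leb_integrable_imp_absolutely_integrable[OF assms] by (simp add: absolutely_integrable_on_def)
  then show ?thesis unfolding primitive_def[abs_def]
    by (intro continuous_intros indefinite_integral_continuous_1)
qed

lemma periodic_pair_primitive:
  assumes "T > 0" "continuous_on {0..T} h" "0 < p"
  shows "periodic_pair T p (primitive T c h) (centered T h)"
proof (rule periodic_pair_continuous[where c = c])
  show "continuous_on {0..T} (centered T h)" unfolding centered_def[abs_def] by (intro continuous_intros assms)
  fix x assume x: "x \<in> {0..T}"
  have "h integrable_on {0..x}" using x by (intro integrable_continuous_real continuous_on_subset[OF assms(2)]) auto
  then show "primitive T c h x = c + integral {0..x} (centered T h)"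
    using x unfolding primitive_def centered_def
    by (subst Henstock_Kurzweil_Integration.integral_diff) auto
qed (use assms in \<open>auto simp: primitive_def\<close>)

lemma abs_integral_le_LINT:
  fixes g G :: "real \<Rightarrow> real"
  assumes "integrable (leb T) g" "integrable (leb T) G" "\<And>x. x \<in> {0<..<T} \<Longrightarrow> \<bar>g x\<bar> \<le> G x" "x \<in> {0..T}"
  shows "\<bar>integral {0..x} g\<bar> \<le> (LINT x|leb T. G x)"
proof -
  have "integral {0..x} g = (LINT y|leb T. indicator {0<..x} y * g y)"
    using LINT_leb_indicator[OF assms(1), of 0 x] assms(4) by simp
  also have "\<bar>\<dots>\<bar> \<le> (LINT x|leb T. G x)"
  proof (rule integral_abs_bound_integral)
    show "integrable (leb T) (\<lambda>y. indicator {0<..x} y * g y)"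
      by (rule integrable_indicator_mult[OF assms(1)])
    show "\<bar>indicator {0<..x} y * g y\<bar> \<le> G y" if "y \<in> space (leb T)" for y
      using assms(3)[of y] that by (auto simp: indicator_def)
  qed (rule assms)
  finally show ?thesis .
qed

text \<open>Domination is imposed on the functions before centering. The dominating function is
  \<open>|g|\<close> when \<open>g\<close> is truncated, and a constant when a truncation is
  approximated by continuous functions.\<close>

lemma energy_primitive_tendsto:
  assumes T: "T > 0" and p: "1 < p" and q: "continuous_on {0..T} q" and w: "continuous_on {0..T} w"
    and G: "G \<in> borel_measurable (leb T)" "integrable (leb T) (\<lambda>x. \<bar>G x\<bar> powr p)"
    and f: "\<And>n. f n \<in> borel_measurable (leb T)" "\<And>n x. x \<in> {0<..<T} \<Longrightarrow> \<bar>f n x\<bar> \<le> G x"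
    and g: "g \<in> borel_measurable (leb T)" "\<And>x. x \<in> {0<..<T} \<Longrightarrow> \<bar>g x\<bar> \<le> G x"
    and lim: "AE x in leb T. (\<lambda>n. f n x) \<longlonglongrightarrow> g x"
  shows "(\<lambda>n. energy T q p (primitive T c (f n)) (centered T (f n)))
            \<longlonglongrightarrow> energy T q p (primitive T c g) (centered T g)" (is ?E)
    and "(\<lambda>n. mass T w p (primitive T c (f n))) \<longlonglongrightarrow> mass T w p (primitive T c g)" (is ?M)
proof -
  note [measurable] = G(1) f(1) g(1)
  have iG: "integrable (leb T) G" by (rule integrable_of_powr[OF G]) (use p in simp)
  have dom: "integrable (leb T) h" if "h \<in> borel_measurable (leb T)" "\<And>x. x \<in> {0<..<T} \<Longrightarrow> \<bar>h x\<bar> \<le> G x" for h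
    by (rule Bochner_Integration.integrable_bound[OF iG that(1)]) (use that(2) in \<open>force intro!: AE_I2\<close>)
  have i_f: "integrable (leb T) (f n)" for n by (rule dom) (use f in auto)
  have i_g: "integrable (leb T) g" by (rule dom) (use g in auto)
  have lim_int: "(\<lambda>n. integral {0..x} (f n)) \<longlonglongrightarrow> integral {0..x} g" if x: "x \<in> {0..T}" for x
  proof -
    note ind = indicator_measurable_leb[of 0 x T]
    have "(\<lambda>n. LINT y|leb T. indicator {0<..x} y * f n y) \<longlonglongrightarrow> (LINT y|leb T. indicator {0<..x} y * g y)"
    proof (rule integral_dominated_convergence[where w = G])
      show "AE y in leb T. (\<lambda>n. indicator {0<..x} y * f n y) \<longlonglongrightarrow> indicator {0<..x} y * g y"
        using lim by eventually_elim (intro tendsto_intros)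
      show "AE y in leb T. norm (indicator {0<..x} y * f n y) \<le> G y" for n
      proof (rule AE_I2)
        fix y assume "y \<in> space (leb T)"
        then show "norm (indicator {0<..x} y * f n y) \<le> G y"
          using f(2)[of y n] by (auto simp: indicator_def)
      qed
    qed (use ind iG in measurable)
    then show ?thesis
      using LINT_leb_indicator[OF i_f, of 0 x] LINT_leb_indicator[OF i_g, of 0 x] x by simp
  qed
  define I where "I = (LINT x|leb T. G x)"
  have bd: "\<bar>integral {0..x} (f n)\<bar> \<le> I" if "x \<in> {0..T}" for n x
    unfolding I_def by (rule abs_integral_le_LINT[OF i_f iG f(2) that])
  have T0: "T \<in> {0..T}" using T by simp
  have cf: "continuous_on {0..T} (primitive T c (f n))" for n by (rule continuous_primitive[OF i_f])
  have cg: "continuous_on {0..T} (primitive T c g)" by (rule continuous_primitive[OF i_g])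
  have lim_mean: "(\<lambda>n. integral {0..T} (f n) / T) \<longlonglongrightarrow> integral {0..T} g / T"
    using T by (intro tendsto_intros lim_int[OF T0]) auto
  have lim_prim: "(\<lambda>n. primitive T c (f n) x) \<longlonglongrightarrow> primitive T c g x" if "x \<in> {0..T}" for x
    unfolding primitive_def by (intro tendsto_add tendsto_diff tendsto_mult tendsto_const lim_int[OF that] lim_mean)
  have I0: "I \<ge> 0" using bd[OF T0] by (meson abs_ge_zero order_trans)
  \<comment> \<open>The integral and the mean correction contribute at most \<open>I\<close>
    each.\<close>
  have bd_prim: "\<bar>primitive T c (f n) x\<bar> \<le> \<bar>c\<bar> + 2 * I" if x: "x \<in> {0..T}" for n x
  proof -
    have "\<bar>x * (integral {0..T} (f n) / T)\<bar> = x / T * \<bar>integral {0..T} (f n)\<bar>" using x T by (simp add: abs_mult)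
    also have "\<dots> \<le> 1 * I" using x T bd[OF T0] by (intro mult_mono) auto
    finally have "\<bar>x * (integral {0..T} (f n) / T)\<bar> \<le> I" by simp
    moreover have "\<bar>c + a - b\<bar> \<le> \<bar>c\<bar> + \<bar>a\<bar> + \<bar>b\<bar>" for a b by linarith
    ultimately show ?thesis unfolding primitive_def using bd[OF x, of n] by (smt (verit))
  qed
  have mass_lim: "(\<lambda>n. mass T a p (primitive T c (f n))) \<longlonglongrightarrow> mass T a p (primitive T c g)"
    if "continuous_on {0..T} a" for a
    by (rule mass_tendsto[OF that cf cg bd_prim lim_prim tendsto_const]) (use p in auto)
  from mass_lim[OF w] show ?M .
  \<comment> \<open>Each mean is at most \<open>I / T\<close> in absolute value, so centering costs
    only this shift of the dominating function.\<close>
  define D where "D = (\<lambda>x. \<bar>G x + I / T\<bar> powr p)"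
  have iD: "integrable (leb T) D"
    unfolding D_def by (rule integrable_powr_add) (use p G integrable_const_leb in auto)
  have cen: "\<bar>centered T h x\<bar> powr p \<le> D x"
    if "\<bar>h x\<bar> \<le> G x" "\<bar>integral {0..T} h\<bar> \<le> I" for h x
  proof -
    have "\<bar>integral {0..T} h / T\<bar> \<le> I / T" using that T by (simp add: divide_right_mono)
    then have "\<bar>centered T h x\<bar> \<le> \<bar>G x + I / T\<bar>" using that unfolding centered_def by linarith
    then show ?thesis unfolding D_def using p by (intro powr_mono2) auto
  qed
  have [measurable]: "centered T (f n) \<in> borel_measurable (leb T)" "centered T g \<in> borel_measurable (leb T)" for n
    unfolding centered_def[abs_def] by measurable
  have bdg: "\<bar>integral {0..T} g\<bar> \<le> I"
    unfolding I_def by (rule abs_integral_le_LINT[OF i_g iG g(2) T0])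
  have grad_lim: "(\<lambda>n. LINT x|leb T. \<bar>centered T (f n) x\<bar> powr p) \<longlonglongrightarrow> (LINT x|leb T. \<bar>centered T g x\<bar> powr p)"
  proof (rule integral_dominated_convergence[where w = D])
    show "AE x in leb T. (\<lambda>n. \<bar>centered T (f n) x\<bar> powr p) \<longlonglongrightarrow> \<bar>centered T g x\<bar> powr p"
      using lim
    proof eventually_elim
      case (elim x)
      then have "(\<lambda>n. centered T (f n) x) \<longlonglongrightarrow> centered T g x"
        unfolding centered_def by (intro tendsto_diff lim_mean)
      then show ?case using p by (intro tendsto_powr' tendsto_rabs tendsto_const) auto
    qed
    show "AE x in leb T. norm (\<bar>centered T (f n) x\<bar> powr p) \<le> D x" for n
      using cen[OF f(2) bd[OF T0]] by (intro AE_I2) simp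
  qed (use iD in measurable)
  have ic: "integrable (leb T) (\<lambda>x. \<bar>centered T h x\<bar> powr p)"
    if [measurable]: "h \<in> borel_measurable (leb T)" and "\<And>x. x \<in> {0<..<T} \<Longrightarrow> \<bar>h x\<bar> \<le> G x" "\<bar>integral {0..T} h\<bar> \<le> I" for h
  proof (rule Bochner_Integration.integrable_bound[OF iD])
    show "(\<lambda>x. \<bar>centered T h x\<bar> powr p) \<in> borel_measurable (leb T)"
      unfolding centered_def by measurable
    show "AE x in leb T. norm (\<bar>centered T h x\<bar> powr p) \<le> norm (D x)"
    proof (rule AE_I2)
      fix x assume "x \<in> space (leb T)"
      then have "\<bar>centered T h x\<bar> powr p \<le> D x" using cen[OF that(2) that(3)] by simp
      then show "norm (\<bar>centered T h x\<bar> powr p) \<le> norm (D x)" by simp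
    qed
  qed
  have "energy T q p (primitive T c (f n)) (centered T (f n))
      = (LINT x|leb T. \<bar>centered T (f n) x\<bar> powr p) + mass T q p (primitive T c (f n))" for n
    using p by (intro energy_split ic f bd[OF T0] q cf) auto
  moreover have "energy T q p (primitive T c g) (centered T g)
      = (LINT x|leb T. \<bar>centered T g x\<bar> powr p) + mass T q p (primitive T c g)"
    using p by (intro energy_split ic g bdg q cg) auto
  ultimately show ?E using tendsto_add[OF grad_lim mass_lim[OF q]] by simp
qed

text \<open>Measurability supplies continuous functions converging off a null set. Clamping them at
  the bound of \<open>g\<close> keeps continuity and the limit, and makes the sequence
  dominated.\<close>

lemma bounded_measurable_approx:
  fixes g :: "real \<Rightarrow> real"
  assumes "g \<in> borel_measurable (leb T)" "\<And>x. x \<in> {0<..<T} \<Longrightarrow> \<bar>g x\<bar> \<le> K"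
  obtains h where "\<And>n. continuous_on UNIV (h n)" "\<And>n x. \<bar>h n x\<bar> \<le> \<bar>K\<bar>" "AE x in leb T. (\<lambda>n. h n x) \<longlonglongrightarrow> g x"
proof -
  have "g measurable_on {0<..<T}" using assms(1) by (simp add: measurable_on_iff_borel_measurable)
  then obtain N h where N: "negligible N" and h: "\<And>n. continuous_on UNIV (h n)"
    and lim: "\<And>x. x \<notin> N \<Longrightarrow> (\<lambda>n. h n x) \<longlonglongrightarrow> (if x \<in> {0<..<T} then g x else 0)"
    unfolding measurable_on_def by metis
  show ?thesis
  proof
    let ?h = "\<lambda>n x. max (- \<bar>K\<bar>) (min \<bar>K\<bar> (h n x))"
    show "continuous_on UNIV (?h n)" for n using h[of n] by (intro continuous_intros) auto
    show "\<bar>?h n x\<bar> \<le> \<bar>K\<bar>" for n x by auto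
    have "N \<in> null_sets lebesgue" using N by (simp add: negligible_iff_null_sets)
    then have "AE x in lebesgue. x \<notin> N" by (rule AE_not_in)
    then have "AE x in leb T. x \<notin> N" by (simp add: AE_restrict_space_iff eventually_mono)
    moreover have "AE x in leb T. x \<in> {0<..<T}" by (rule AE_I2) simp
    ultimately show "AE x in leb T. (\<lambda>n. ?h n x) \<longlonglongrightarrow> g x"
    proof eventually_elim
      case (elim x)
      then have "(\<lambda>n. h n x) \<longlonglongrightarrow> g x" using lim[of x] by simp
      then have "(\<lambda>n. ?h n x) \<longlonglongrightarrow> max (- \<bar>K\<bar>) (min \<bar>K\<bar> (g x))"
        by (intro tendsto_max tendsto_min tendsto_const)
      moreover have "max (- \<bar>K\<bar>) (min \<bar>K\<bar> (g x)) = g x" using assms(2)[of x] elim by auto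
      ultimately show ?case by simp
    qed
  qed
qed

text \<open>Two stages with tolerance \<open>e/2\<close> each. Truncating first gives the continuous
  approximations a common bound, hence a dominating function.\<close>

lemma approx_by_continuous:
  assumes T: "T > 0" and p: "1 < p" and q: "continuous_on {0..T} q" and w: "continuous_on {0..T} w"
    and W: "periodic_pair T p u g" and e: "e > 0"
  obtains c h where "continuous_on {0..T} h"
    "\<bar>energy T q p (primitive T c h) (centered T h) - energy T q p u g\<bar> < e"
    "\<bar>mass T w p (primitive T c h) - mass T w p u\<bar> < e"
proof -
  define c where "c = u 0"
  have int: "u x = c + integral {0..x} g" if "x \<in> {0..T}" for x
    unfolding c_def by (rule periodic_pair_integral[OF W _ that]) (use p in simp)
  \<comment> \<open>Periodicity of \<open>u\<close> says that \<open>g\<close> has zero mean, so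
    \<open>primitive\<close> and \<open>centered\<close> reproduce \<open>u\<close> and
    \<open>g\<close>.\<close>
  have g0: "integral {0..T} g = 0" using int[of T] periodic_pairD(2)[OF W] T by (simp add: c_def)
  have E: "energy T q p (primitive T c g) (centered T g) = energy T q p u g"
    unfolding energy_def centered_def primitive_def g0
    by (rule Bochner_Integration.integral_cong) (simp_all add: int)
  have M: "mass T w p (primitive T c g) = mass T w p u"
    unfolding mass_def primitive_def g0
    by (rule Bochner_Integration.integral_cong) (simp_all add: int)
  note [measurable] = periodic_pairD(4)[OF W]
  define t where "t = (\<lambda>n x. max (- real n) (min (real n) (g x)))"
  have [measurable]: "t n \<in> borel_measurable (leb T)" for n unfolding t_def by measurable
  have tb: "\<bar>t n x\<bar> \<le> \<bar>g x\<bar>" "\<bar>t n x\<bar> \<le> real n" for n x unfolding t_def by auto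
  have tl: "(\<lambda>n. t n x) \<longlonglongrightarrow> g x" for x
  proof (rule tendsto_eventually)
    obtain N :: nat where "real N \<ge> \<bar>g x\<bar>" using real_arch_simple by blast
    then show "\<forall>\<^sub>F n in sequentially. t n x = g x"
      by (intro eventually_sequentiallyI[of N]) (auto simp: t_def)
  qed
  have G: "integrable (leb T) (\<lambda>x. \<bar>\<bar>g x\<bar>\<bar> powr p)" using periodic_pairD(5)[OF W] by simp
  have "(\<lambda>n. energy T q p (primitive T c (t n)) (centered T (t n))) \<longlonglongrightarrow> energy T q p u g"
    unfolding E[symmetric]
    by (rule energy_primitive_tendsto(1)[OF T p q w _ G]) (use tb tl in \<open>auto intro!: AE_I2\<close>)
  moreover have "(\<lambda>n. mass T w p (primitive T c (t n))) \<longlonglongrightarrow> mass T w p u"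
    unfolding M[symmetric]
    by (rule energy_primitive_tendsto(2)[OF T p q w _ G]) (use tb tl in \<open>auto intro!: AE_I2\<close>)
  ultimately have "\<forall>\<^sub>F n in sequentially. \<bar>energy T q p (primitive T c (t n)) (centered T (t n)) - energy T q p u g\<bar> < e/2
      \<and> \<bar>mass T w p (primitive T c (t n)) - mass T w p u\<bar> < e/2"
    using half_gt_zero[OF e] unfolding tendsto_iff dist_real_def by (intro eventually_conj) blast+
  then obtain k where k: "\<bar>energy T q p (primitive T c (t k)) (centered T (t k)) - energy T q p u g\<bar> < e/2"
      "\<bar>mass T w p (primitive T c (t k)) - mass T w p u\<bar> < e/2"
    by (auto dest: eventually_happens)
  obtain h where h: "\<And>n. continuous_on UNIV (h n)" "\<And>n x. \<bar>h n x\<bar> \<le> \<bar>real k\<bar>" "AE x in leb T. (\<lambda>n. h n x) \<longlonglongrightarrow> t k x"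
    using bounded_measurable_approx[of "t k" T "real k"] tb by (metis \<open>\<And>n. t n \<in> borel_measurable (leb T)\<close>)
  have hc: "continuous_on {0..T} (h n)" for n by (rule continuous_on_subset[OF h(1)]) simp
  note [measurable] = borel_measurable_leb_continuous[OF hc]
  have K: "integrable (leb T) (\<lambda>x. \<bar>real k\<bar> powr p)" by (rule integrable_const_leb)
  have "(\<lambda>n. energy T q p (primitive T c (h n)) (centered T (h n)))
          \<longlonglongrightarrow> energy T q p (primitive T c (t k)) (centered T (t k))"
    by (rule energy_primitive_tendsto(1)[OF T p q w _ K]) (use tb h in auto)
  moreover have "(\<lambda>n. mass T w p (primitive T c (h n))) \<longlonglongrightarrow> mass T w p (primitive T c (t k))"
    by (rule energy_primitive_tendsto(2)[OF T p q w _ K]) (use tb h in auto)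
  ultimately have "\<forall>\<^sub>F n in sequentially.
      \<bar>energy T q p (primitive T c (h n)) (centered T (h n)) - energy T q p (primitive T c (t k)) (centered T (t k))\<bar> < e/2
      \<and> \<bar>mass T w p (primitive T c (h n)) - mass T w p (primitive T c (t k))\<bar> < e/2"
    using half_gt_zero[OF e] unfolding tendsto_iff dist_real_def by (intro eventually_conj) blast+
  then obtain n where "\<bar>energy T q p (primitive T c (h n)) (centered T (h n)) - energy T q p (primitive T c (t k)) (centered T (t k))\<bar> < e/2"
      "\<bar>mass T w p (primitive T c (h n)) - mass T w p (primitive T c (t k))\<bar> < e/2"
    by (auto dest: eventually_happens)
  then show ?thesis using k by (intro that[OF hc[of n], of c]) linarith+
qed

lemma near_infimum:
  assumes "constrained_energies T q w p \<noteq> {}" "e > 0"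
  shows "\<exists>E\<in>constrained_energies T q w p. E < lambda_plus T q w p + e"
  using cInf_lessD[OF assms(1), of "lambda_plus T q w p + e"] assms(2) unfolding lambda_plus_def by auto

lemma lambda_plus_upper_semicontinuous:
  assumes T: "T > 0" and q: "continuous_on {0..T} q" "\<forall>x\<in>{0..T}. q x \<ge> 0"
    and w: "continuous_on {0..T} w" and ne: "constrained_energies T q w p0 \<noteq> {}"
    and p: "p \<longlonglongrightarrow> p0" "p0 > 1" "\<And>n. p n > 1" and e: "e > 0"
  shows "\<forall>\<^sub>F n in sequentially. lambda_plus T q w (p n) < lambda_plus T q w p0 + e"
proof -
  obtain E where E: "E \<in> constrained_energies T q w p0" "E < lambda_plus T q w p0 + e"
    using near_infimum[OF ne e] by blast
  then obtain u g where W: "periodic_pair T p0 u g" and m: "mass T w p0 u = 1" and Eu: "E = energy T q p0 u g"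
    unfolding constrained_energies_eq by blast
  have "\<exists>c h. continuous_on {0..T} h \<and>
      \<bar>energy T q p0 (primitive T c h) (centered T h) - E\<bar> < 1 / real (Suc j) \<and>
      \<bar>mass T w p0 (primitive T c h) - 1\<bar> < 1 / real (Suc j)" for j
    using approx_by_continuous[OF T p(2) q(1) w W, of "1 / real (Suc j)"] unfolding m Eu
    by (metis of_nat_0_less_iff zero_less_Suc zero_less_divide_1_iff)
  then obtain c h where h: "\<And>j. continuous_on {0..T} (h j)"
     "\<And>j. \<bar>energy T q p0 (primitive T (c j) (h j)) (centered T (h j)) - E\<bar> < 1 / real (Suc j)"
     "\<And>j. \<bar>mass T w p0 (primitive T (c j) (h j)) - 1\<bar> < 1 / real (Suc j)"
    by metis
  have z: "(\<lambda>j. 1 / real (Suc j)) \<longlonglongrightarrow> 0" by (rule LIMSEQ_Suc[OF lim_1_over_n])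
  have "(\<lambda>j. energy T q p0 (primitive T (c j) (h j)) (centered T (h j)) - E) \<longlonglongrightarrow> 0"
    by (rule Lim_null_comparison[OF _ z]) (use h(2) in \<open>auto intro!: always_eventually less_imp_le\<close>)
  then have l1: "(\<lambda>j. energy T q p0 (primitive T (c j) (h j)) (centered T (h j))) \<longlonglongrightarrow> E" by (simp add: LIM_zero_iff)
  have "(\<lambda>j. mass T w p0 (primitive T (c j) (h j)) - 1) \<longlonglongrightarrow> 0"
    by (rule Lim_null_comparison[OF _ z]) (use h(3) in \<open>auto intro!: always_eventually less_imp_le\<close>)
  then have l2: "(\<lambda>j. mass T w p0 (primitive T (c j) (h j))) \<longlonglongrightarrow> 1" by (simp add: LIM_zero_iff)
  \<comment> \<open>The approximants have mass only close to 1, so the quotient takes the place of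
    the energy; its limit \<open>E\<close> still lies strictly below the bound.\<close>
  have "\<forall>\<^sub>F j in sequentially. energy T q p0 (primitive T (c j) (h j)) (centered T (h j)) / mass T w p0 (primitive T (c j) (h j))
       < lambda_plus T q w p0 + e"
    using tendsto_divide[OF l1 l2] E(2) by (intro order_tendstoD(2)) auto
  moreover have "\<forall>\<^sub>F j in sequentially. mass T w p0 (primitive T (c j) (h j)) > 0"
    using l2 by (rule order_tendstoD(1)) simp
  ultimately have "\<forall>\<^sub>F j in sequentially. energy T q p0 (primitive T (c j) (h j)) (centered T (h j)) / mass T w p0 (primitive T (c j) (h j))
       < lambda_plus T q w p0 + e \<and> mass T w p0 (primitive T (c j) (h j)) > 0" by (rule eventually_conj)
  then obtain j where j: "energy T q p0 (primitive T (c j) (h j)) (centered T (h j)) / mass T w p0 (primitive T (c j) (h j))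
       < lambda_plus T q w p0 + e" "mass T w p0 (primitive T (c j) (h j)) > 0"
    by (auto dest: eventually_happens)
  define v where "v = primitive T (c j) (h j)"
  define d where "d = centered T (h j)"
  have W: "periodic_pair T r v d" if "r > 0" for r
    unfolding v_def d_def by (rule periodic_pair_primitive[OF T h(1) that])
  have cv: "continuous_on {0..T} v" using W[of 1] periodic_pairD(1) by simp
  have cd: "continuous_on {0..T} d" unfolding d_def centered_def[abs_def] by (intro continuous_intros h)
  obtain B where B: "\<And>x. x \<in> {0..T} \<Longrightarrow> \<bar>v x\<bar> \<le> B" using continuous_bounded_Icc[OF cv] by metis
  obtain B' where B': "\<And>x. x \<in> {0..T} \<Longrightarrow> \<bar>d x\<bar> \<le> B'" using continuous_bounded_Icc[OF cd] by metis
  have pp: "p n > 0" "p0 > 0" for n using p(2) p(3)[of n] by auto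
  have ml: "(\<lambda>n. mass T a (p n) v) \<longlonglongrightarrow> mass T a p0 v" if "continuous_on {0..T} a" for a
    by (rule mass_tendsto[OF that cv cv B _ p(1)]) (use pp in auto)
  \<comment> \<open>The derivative part of the energy is treated as a mass with weight 1.\<close>
  have "(\<lambda>n. mass T (\<lambda>_. 1) (p n) d) \<longlonglongrightarrow> mass T (\<lambda>_. 1) p0 d"
    by (rule mass_tendsto[OF _ cd cd B' _ p(1)]) (use pp in auto)
  then have dl: "(\<lambda>n. LINT x|leb T. \<bar>d x\<bar> powr p n) \<longlonglongrightarrow> (LINT x|leb T. \<bar>d x\<bar> powr p0)"
    by (simp add: mass_def)
  have es: "energy T q r v d = (LINT x|leb T. \<bar>d x\<bar> powr r) + mass T q r v" if "r > 0" for r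
    by (rule energy_split[OF integrable_powr_continuous[OF cd that] q(1) cv that])
  have "(\<lambda>n. energy T q (p n) v d) \<longlonglongrightarrow> energy T q p0 v d"
    using tendsto_add[OF dl ml[OF q(1)]] by (simp add: es pp)
  then have "(\<lambda>n. energy T q (p n) v d / mass T w (p n) v) \<longlonglongrightarrow> energy T q p0 v d / mass T w p0 v"
    using j(2) by (intro tendsto_divide ml w) (auto simp: v_def)
  then have "\<forall>\<^sub>F n in sequentially. energy T q (p n) v d / mass T w (p n) v < lambda_plus T q w p0 + e"
    using j(1) unfolding v_def d_def by (rule order_tendstoD(2))
  moreover have "\<forall>\<^sub>F n in sequentially. mass T w (p n) v > 0"
    using ml[OF w] j(2) unfolding v_def by (rule order_tendstoD(1))
  ultimately show ?thesis
  proof eventually_elim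
    case (elim n)
    have "lambda_plus T q w (p n) \<le> energy T q (p n) v d / mass T w (p n) v"
      by (rule lambda_plus_le[OF q(2) W _ elim(2)]) (use pp p(3)[of n] in auto)
    then show ?case using elim(1) by simp
  qed
qed

section \<open>Compactness of almost-minimisers\<close>

lemma periodic_pair_diff:
  assumes W: "periodic_pair T p u g" and p: "1 \<le> p" and xy: "0 \<le> x" "x \<le> y" "y \<le> T"
  shows "\<bar>u y - u x\<bar> \<le> (LINT t|leb T. indicator {x<..y} t * \<bar>g t\<bar>)"
proof -
  have ig: "integrable (leb T) g" by (rule periodic_pair_integrable[OF W p])
  then have int: "g integrable_on {0..T}"
    using leb_integrable_imp_absolutely_integrable by (simp add: absolutely_integrable_on_def)
  have "g integrable_on {0..y}" by (rule integrable_subinterval_real[OF int]) (use xy in auto)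
  then have "integral {0..x} g + integral {x..y} g = integral {0..y} g"
    using xy by (intro Henstock_Kurzweil_Integration.integral_combine) auto
  then have "u y - u x = integral {x..y} g"
    using periodic_pair_integral[OF W p, of x] periodic_pair_integral[OF W p, of y] xy by simp
  also have "\<dots> = (LINT t|leb T. indicator {x<..y} t * g t)"
    using LINT_leb_indicator[OF ig xy] by simp
  finally have "\<bar>u y - u x\<bar> = \<bar>LINT t|leb T. indicator {x<..y} t * g t\<bar>" by simp
  also have "\<dots> \<le> (LINT t|leb T. \<bar>indicator {x<..y} t * g t\<bar>)" by (rule integral_abs_bound)
  finally show ?thesis by (simp add: abs_mult)
qed

text \<open>The oscillation over an interval is at most the integral of \<open>|g|\<close>, and the
  split \<open>|g| <= e' * |g| powr p + C\<close> bounds this by \<open>e' * K\<close> plus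
  \<open>C\<close> times the length. The resulting \<open>d\<close> is the same for all exponents
  from \<open>r\<close> on.\<close>

lemma periodic_pair_equicontinuous:
  assumes r: "1 < r" and K: "K \<ge> 0" and e: "e > 0"
  obtains d where "d > 0"
    "\<And>p u g x y. r \<le> p \<Longrightarrow> periodic_pair T p u g \<Longrightarrow> (LINT x|leb T. \<bar>g x\<bar> powr p) \<le> K \<Longrightarrow>
       x \<in> {0..T} \<Longrightarrow> y \<in> {0..T} \<Longrightarrow> \<bar>x - y\<bar> < d \<Longrightarrow> \<bar>u x - u y\<bar> < e"
proof -
  \<comment> \<open>The summand 1 avoids division by zero when \<open>K = 0\<close> and makes
    \<open>e' * K < e / 2\<close> strict.\<close>
  define e' where "e' = e / (2 * (K + 1))"
  have e': "e' > 0" "e' * K < e / 2" using e K by (auto simp: e'_def field_simps)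
  obtain C where C: "C \<ge> 1" "\<And>s p. r \<le> p \<Longrightarrow> \<bar>s\<bar> \<le> e' * \<bar>s\<bar> powr p + C"
    using abs_le_eps_powr[OF r e'(1)] by metis
  show ?thesis
  proof
    show "e / (2 * C) > 0" using e C by simp
    fix p u g x y
    assume p: "r \<le> p" and W: "periodic_pair T p u g" and E: "(LINT x|leb T. \<bar>g x\<bar> powr p) \<le> K"
      and x: "x \<in> {0..T}" and y: "y \<in> {0..T}" and xy: "\<bar>x - y\<bar> < e / (2 * C)"
    have main: "\<bar>u b - u a\<bar> < e" if ab: "0 \<le> a" "a \<le> b" "b \<le> T" "b - a < e / (2 * C)" for a b
    proof -
      have ip: "integrable (leb T) (\<lambda>t. \<bar>g t\<bar> powr p)" by (rule periodic_pairD[OF W])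
      have i1: "integrable (leb T) (\<lambda>t. indicator {a<..b} t * \<bar>g t\<bar>)"
        using periodic_pair_integrable[OF W] p r by (intro integrable_indicator_mult) auto
      have i2: "integrable (leb T) (\<lambda>t. indicator {a<..b} t * C)"
        by (intro integrable_indicator_mult integrable_const_leb)
      have le: "\<bar>u b - u a\<bar> \<le> (LINT t|leb T. indicator {a<..b} t * \<bar>g t\<bar>)"
        by (rule periodic_pair_diff[OF W]) (use p r ab in auto)
      also have "\<dots> \<le> (LINT t|leb T. e' * \<bar>g t\<bar> powr p + indicator {a<..b} t * C)"
      proof (rule integral_mono[OF i1])
        show "indicator {a<..b} t * \<bar>g t\<bar> \<le> e' * \<bar>g t\<bar> powr p + indicator {a<..b} t * C" for t
          using C(2)[OF p, of "g t"] e' by (auto simp: indicator_def)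
      qed (use ip i2 in auto)
      also have "\<dots> = e' * (LINT t|leb T. \<bar>g t\<bar> powr p) + (LINT t|leb T. indicator {a<..b} t * C)"
        using ip i2 by simp
      also have "(LINT t|leb T. indicator {a<..b} t * C) = C * (b - a)"
        using LINT_leb_indicator[OF integrable_const_leb, of a b T C] ab by simp
      also have "e' * (LINT t|leb T. \<bar>g t\<bar> powr p) \<le> e' * K" using E e' by (intro mult_left_mono) auto
      also have "C * (b - a) < e / 2" using ab(4) C(1) by (simp add: field_simps)
      finally show ?thesis using e' by linarith
    qed
    show "\<bar>u x - u y\<bar> < e"
      using main[of x y] main[of y x] x y xy by (cases "x \<le> y") (auto simp: abs_minus_commute)
  qed
qed

lemma integral_pos:
  assumes "T > 0" "continuous_on {0..T} q" "\<forall>x\<in>{0..T}. q x \<ge> 0" "\<exists>x\<in>{0..T}. q x \<noteq> (0::real)"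
  shows "(LINT x|leb T. q x) > 0"
proof -
  have eq: "(LINT x|leb T. q x) = integral {0..T} q"
    by (rule LINT_leb_eq_integral[OF integrable_leb_continuous[OF assms(2)]])
  have "(LINT x|leb T. q x) \<noteq> 0"
    using integral_eq_0_iff[OF assms(2,1)] assms(3,4) unfolding eq by auto
  moreover have "(LINT x|leb T. q x) \<ge> 0" using assms(3) by (intro Bochner_Integration.integral_nonneg) auto
  ultimately show ?thesis by simp
qed

text \<open>Because \<open>q\<close> has positive integral, the \<open>q\<close>-weighted part of
  the energy controls the minimum of \<open>|u|\<close>; the oscillation is at most
  \<open>K + T\<close> since \<open>|g| <= |g| powr p + 1\<close>. The resulting bound is the same
  for all exponents.\<close>

lemma periodic_pair_bounded:
  assumes T: "T > 0" and q: "continuous_on {0..T} q" "\<forall>x\<in>{0..T}. q x \<ge> 0" "\<exists>x\<in>{0..T}. q x \<noteq> 0"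
    and W: "periodic_pair T p u g" and p: "1 \<le> p" and K: "energy T q p u g \<le> K" and x: "x \<in> {0..T}"
  shows "\<bar>u x\<bar> \<le> 1 + K / (LINT x|leb T. q x) + (K + T)"
proof -
  note ip = periodic_pairD(5)[OF W] and cu = periodic_pairD(1)[OF W]
  have es: "energy T q p u g = (LINT x|leb T. \<bar>g x\<bar> powr p) + mass T q p u"
    by (rule energy_split[OF ip q(1) cu]) (use p in simp)
  have gK: "(LINT x|leb T. \<bar>g x\<bar> powr p) \<le> K" using es mass_nonneg[OF q(2), of p u] K by simp
  have "(LINT x|leb T. \<bar>g x\<bar> powr p) \<ge> 0" by (rule Bochner_Integration.integral_nonneg) simp
  then have mK: "mass T q p u \<le> K" using es K by linarith
  have one: "\<bar>s\<bar> \<le> \<bar>s\<bar> powr p + 1" for s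
  proof -
    have "\<bar>s\<bar> powr 1 \<le> \<bar>s\<bar> powr p + (1 - 1 / p)" by (rule powr_le_powr_add) (use p in auto)
    moreover have "1 / p \<ge> 0" using p by simp
    moreover have "\<bar>s\<bar> powr 1 = \<bar>s\<bar>" by simp
    ultimately show ?thesis by linarith
  qed
  have ig: "integrable (leb T) (\<lambda>x. \<bar>g x\<bar>)" using periodic_pair_integrable[OF W p] by simp
  have osc: "\<bar>u b - u a\<bar> \<le> K + T" if ab: "0 \<le> a" "a \<le> b" "b \<le> T" for a b
  proof -
    have "\<bar>u b - u a\<bar> \<le> (LINT t|leb T. indicator {a<..b} t * \<bar>g t\<bar>)"
      by (rule periodic_pair_diff[OF W p ab])
    also have "\<dots> \<le> (LINT t|leb T. \<bar>g t\<bar> powr p + 1)"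
    proof (rule integral_mono[OF integrable_indicator_mult[OF ig]])
      show "indicator {a<..b} t * \<bar>g t\<bar> \<le> \<bar>g t\<bar> powr p + 1" for t
        using one[of "g t"] by (auto simp: indicator_def)
    qed (use ip integrable_const_leb in auto)
    also have "\<dots> = (LINT t|leb T. \<bar>g t\<bar> powr p) + (LINT t|leb T. 1)"
      by (rule Bochner_Integration.integral_add[OF ip integrable_const_leb])
    also have "\<dots> \<le> K + T" using gK LINT_const_leb[OF T, of 1] by simp
    finally show ?thesis .
  qed
  have "continuous_on {0..T} (\<lambda>x. \<bar>u x\<bar>)" by (intro continuous_intros cu)
  then obtain x1 where x1: "x1 \<in> {0..T}" "\<And>y. y \<in> {0..T} \<Longrightarrow> \<bar>u x1\<bar> \<le> \<bar>u y\<bar>"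
    using continuous_attains_inf[of "{0..T}" "\<lambda>x. \<bar>u x\<bar>"] T by auto
  define Q where "Q = (LINT x|leb T. q x)"
  have Q: "Q > 0" unfolding Q_def by (rule integral_pos[OF T q])
  have "\<bar>u x1\<bar> powr p * Q = (LINT x|leb T. q x * \<bar>u x1\<bar> powr p)" by (simp add: Q_def mult.commute)
  also have "\<dots> \<le> mass T q p u"
    unfolding mass_def
  proof (rule integral_mono)
    show "integrable (leb T) (\<lambda>x. q x * \<bar>u x\<bar> powr p)"
      by (rule integrable_weighted_powr[OF q(1) cu]) (use p in simp)
    show "integrable (leb T) (\<lambda>x. q x * \<bar>u x1\<bar> powr p)"
      using integrable_leb_continuous[OF q(1)] by simp
    fix y assume "y \<in> space (leb T)"
    then have y: "y \<in> {0..T}" by simp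
    then show "q y * \<bar>u x1\<bar> powr p \<le> q y * \<bar>u y\<bar> powr p"
      using x1(2)[OF y] q(2) p by (intro mult_left_mono powr_mono2) auto
  qed
  also have "\<dots> \<le> K" by fact
  finally have "\<bar>u x1\<bar> powr p \<le> K / Q" using Q by (simp add: field_simps)
  moreover have "\<bar>u x1\<bar> \<le> \<bar>u x1\<bar> powr p + 1" by (rule one)
  moreover have "\<bar>u x - u x1\<bar> \<le> K + T"
    using osc[of x x1] osc[of x1 x] x x1(1) by (cases "x \<le> x1") (auto simp: abs_minus_commute)
  ultimately show ?thesis unfolding Q_def by linarith
qed

section \<open>Convergence of the derivatives of almost-minimisers\<close>

lemma LINT_powr_le:
  fixes g :: "real \<Rightarrow> real"
  assumes T: "T > 0" and g: "g \<in> borel_measurable (leb T)" "integrable (leb T) (\<lambda>x. \<bar>g x\<bar> powr p)" and s: "0 < s" "s \<le> p"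
  shows "(LINT x|leb T. \<bar>g x\<bar> powr s) \<le> (LINT x|leb T. \<bar>g x\<bar> powr p) + T * (1 - s / p)"
proof -
  have "(LINT x|leb T. \<bar>g x\<bar> powr s) \<le> (LINT x|leb T. \<bar>g x\<bar> powr p + (1 - s/p))"
    by (rule integral_mono[OF integrable_powr_mono[OF g s]])
       (use g(2) integrable_const_leb powr_le_powr_add[OF s] in auto)
  also have "\<dots> = (LINT x|leb T. \<bar>g x\<bar> powr p) + (LINT x|leb T. (1 - s/p))"
    by (rule Bochner_Integration.integral_add[OF g(2) integrable_const_leb])
  finally show ?thesis by (simp only: LINT_const_leb[OF T])
qed

text \<open>The midpoint of two almost-minimisers is a competitor, so their convexity defect is small;
  the midpoint has only the smaller of the two exponents of integrability.\<close>

lemma almost_minimisers_L1_close: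
  assumes T: "T > 0" and q: "continuous_on {0..T} q" "\<forall>x\<in>{0..T}. q x \<ge> 0" and w: "continuous_on {0..T} w"
    and r: "1 < r" "\<And>n. r \<le> p n" "\<And>n. r \<le> p' n"
    and p: "p \<longlonglongrightarrow> p0" "p' \<longlonglongrightarrow> p0"
    and W: "\<And>n. periodic_pair T (p n) (u n) (g n)" "\<And>n. periodic_pair T (p' n) (u' n) (g' n)"
    and B: "\<And>n x. x \<in> {0..T} \<Longrightarrow> \<bar>u n x\<bar> \<le> B" "\<And>n x. x \<in> {0..T} \<Longrightarrow> \<bar>u' n x\<bar> \<le> B"
    and v: "continuous_on {0..T} v" "\<And>x. x \<in> {0..T} \<Longrightarrow> (\<lambda>n. u n x) \<longlonglongrightarrow> v x"
       "\<And>x. x \<in> {0..T} \<Longrightarrow> (\<lambda>n. u' n x) \<longlonglongrightarrow> v x" "mass T w p0 v = 1"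
    and A: "(\<lambda>n. LINT x|leb T. \<bar>g n x\<bar> powr p n) \<longlonglongrightarrow> L - mass T q p0 v"
       "(\<lambda>n. LINT x|leb T. \<bar>g' n x\<bar> powr p' n) \<longlonglongrightarrow> L - mass T q p0 v"
    and lam: "(\<lambda>n. lambda_plus T q w (min (p n) (p' n))) \<longlonglongrightarrow> L"
  shows "(\<lambda>n. LINT x|leb T. \<bar>g n x - g' n x\<bar>) \<longlonglongrightarrow> 0"
proof -
  define s where "s = (\<lambda>n. min (p n) (p' n))"
  define a where "a = L - mass T q p0 v"
  define z where "z = (\<lambda>n x. 1/2 * u n x + 1/2 * u' n x)"
  define k where "k = (\<lambda>n x. 1/2 * g n x + 1/2 * g' n x)"
  have rs: "r \<le> s n" "s n \<le> p n" "s n \<le> p' n" for n using r by (auto simp: s_def)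
  have s1: "1 \<le> s n" "0 < s n" "1 \<le> p n" "1 \<le> p' n" "0 < p n" "0 < p' n" for n
    using rs[of n] r(1) r(2,3)[of n] by auto
  have sl: "s \<longlonglongrightarrow> p0" unfolding s_def using tendsto_min[OF p] by simp
  have p0: "r \<le> p0" using LIMSEQ_le_const[OF p(1)] r(2) by blast
  have Ws: "periodic_pair T (s n) (u n) (g n)" "periodic_pair T (s n) (u' n) (g' n)" for n
    using periodic_pair_mono[OF W(1) s1(2) rs(2)] periodic_pair_mono[OF W(2) s1(2) rs(3)] by auto
  have Wz: "periodic_pair T (s n) (z n) (k n)" for n
    unfolding z_def k_def by (rule periodic_pair_combine[OF Ws s1(1)])
  note [measurable] = periodic_pairD(4)[OF W(1)] periodic_pairD(4)[OF W(2)]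
  have iz: "integrable (leb T) (\<lambda>x. \<bar>k n x\<bar> powr s n)" for n by (rule periodic_pairD(5)[OF Wz])
  have i1: "integrable (leb T) (\<lambda>x. \<bar>g n x\<bar> powr s n)" for n by (rule periodic_pairD(5)[OF Ws(1)])
  have i2: "integrable (leb T) (\<lambda>x. \<bar>g' n x\<bar> powr s n)" for n by (rule periodic_pairD(5)[OF Ws(2)])
  have zl: "(\<lambda>n. z n x) \<longlonglongrightarrow> v x" if "x \<in> {0..T}" for x
    using tendsto_add[OF tendsto_mult_left[OF v(2)[OF that], of "1/2"] tendsto_mult_left[OF v(3)[OF that], of "1/2"]]
    by (simp add: z_def)
  have zB: "\<bar>z n x\<bar> \<le> B" if "x \<in> {0..T}" for n x
    using B(1)[OF that, of n] B(2)[OF that, of n] unfolding z_def by linarith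
  have ml: "(\<lambda>n. mass T c (s n) (z n)) \<longlonglongrightarrow> mass T c p0 v" if "continuous_on {0..T} c" for c
    by (rule mass_tendsto[OF that periodic_pairD(1)[OF Wz] v(1) zB zl sl]) (use p0 r s1 in auto)
  \<comment> \<open>By definition of \<open>lambda_plus\<close> at the smaller exponent,
    \<open>b n\<close> bounds the derivative energy of the midpoint from below once its mass is
    positive. As the masses converge, \<open>b\<close> has the same limit \<open>a\<close> as the
    derivative energies of the two given sequences.\<close>
  define b where "b = (\<lambda>n. lambda_plus T q w (s n) * mass T w (s n) (z n) - mass T q (s n) (z n))"
  have bl: "b \<longlonglongrightarrow> a"
    unfolding b_def a_def using tendsto_diff[OF tendsto_mult[OF lam ml[OF w]] ml[OF q(1)]] v(4)
    by (simp add: s_def)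
  have ev: "\<forall>\<^sub>F n in sequentially. b n \<le> (LINT x|leb T. \<bar>k n x\<bar> powr s n)"
  proof -
    have "\<forall>\<^sub>F n in sequentially. mass T w (s n) (z n) > 0"
      using ml[OF w] v(4) by (intro order_tendstoD(1)) auto
    then show ?thesis
    proof eventually_elim
      case (elim n)
      have "lambda_plus T q w (s n) \<le> energy T q (s n) (z n) (k n) / mass T w (s n) (z n)"
        by (rule lambda_plus_le[OF q(2) Wz s1(1) elim])
      then have "lambda_plus T q w (s n) * mass T w (s n) (z n) \<le> energy T q (s n) (z n) (k n)"
        using elim by (simp add: pos_le_divide_eq)
      moreover have "energy T q (s n) (z n) (k n) = (LINT x|leb T. \<bar>k n x\<bar> powr s n) + mass T q (s n) (z n)"
        by (rule energy_split[OF iz q(1) periodic_pairD(1)[OF Wz] s1(2)])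
      ultimately show ?case unfolding b_def by simp
    qed
  qed
  \<comment> \<open>Upper bounds for the derivative energies at the smaller exponent; the loss
    \<open>T * (1 - s n / p n)\<close> vanishes because all exponents tend to
    \<open>p0\<close>.\<close>
  define A1 where "A1 = (\<lambda>n. (LINT x|leb T. \<bar>g n x\<bar> powr p n) + T * (1 - s n / p n))"
  define A2 where "A2 = (\<lambda>n. (LINT x|leb T. \<bar>g' n x\<bar> powr p' n) + T * (1 - s n / p' n))"
  have A1: "(LINT x|leb T. \<bar>g n x\<bar> powr s n) \<le> A1 n" for n
    unfolding A1_def by (rule LINT_powr_le[OF T _ periodic_pairD(5)[OF W(1)] s1(2) rs(2)]) measurable
  have A2: "(LINT x|leb T. \<bar>g' n x\<bar> powr s n) \<le> A2 n" for n
    unfolding A2_def by (rule LINT_powr_le[OF T _ periodic_pairD(5)[OF W(2)] s1(2) rs(3)]) measurable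
  have p0n: "p0 \<noteq> 0" using p0 r by simp
  have "A1 \<longlonglongrightarrow> a + T * (1 - p0 / p0)"
    unfolding A1_def a_def by (intro tendsto_intros A sl p p0n)
  then have A1l: "A1 \<longlonglongrightarrow> a" using p0n by simp
  have "A2 \<longlonglongrightarrow> a + T * (1 - p0 / p0)"
    unfolding A2_def a_def by (intro tendsto_intros A sl p p0n)
  then have A2l: "A2 \<longlonglongrightarrow> a" using p0n by simp
  obtain P where P: "\<And>n. s n \<le> P"
    using Bseq_eq_bounded convergent_imp_Bseq sl by (metis Bseq_def convergentI abs_le_D1 real_norm_def)
  have a0: "a \<ge> 0" unfolding a_def
    by (rule LIMSEQ_le_const[OF A(1)]) (auto intro!: Bochner_Integration.integral_nonneg)
  show ?thesis
  proof (rule tendstoI)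
    fix e :: real assume e: "e > 0"
    \<comment> \<open>In the limit \<open>A1\<close>, \<open>A2\<close> and \<open>b\<close> all
      become \<open>a\<close>: the defect term cancels whatever the size of \<open>C\<close>, and
      what remains, \<open>e' * (T + 2 * a)\<close>, equals \<open>e / 2\<close>.\<close>
    define e' where "e' = e / (2 * (T + 2 * a))"
    have pos: "T + 2 * a > 0" using T a0 by simp
    have "e' * (T + 2 * a) = e / 2"
      unfolding e'_def using pos by (simp add: divide_simps del: distrib_left_numeral)
    then have e': "e' * (T + 2 * a) < e" "e' > 0" using e by linarith (use e pos in \<open>simp add: e'_def\<close>)
    obtain C where C: "C \<ge> 0" "\<And>p a b. r \<le> p \<Longrightarrow> p \<le> P \<Longrightarrow> \<bar>a - b\<bar> \<le> e' * (1 + \<bar>a\<bar> powr p + \<bar>b\<bar> powr p)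
        + C * ((\<bar>a\<bar> powr p + \<bar>b\<bar> powr p) / 2 - \<bar>(a + b) / 2\<bar> powr p)"
      using abs_diff_le_convexity_defect[OF r(1) e'(2), of P] by metis
    define R where "R = (\<lambda>n. e' * (T + A1 n + A2 n) + C * ((A1 n + A2 n) / 2 - b n))"
    have "R \<longlonglongrightarrow> e' * (T + a + a) + C * ((a + a) / 2 - a)"
      unfolding R_def by (intro tendsto_intros A1l A2l bl) simp
    then have "R \<longlonglongrightarrow> e' * (T + 2 * a)" by (simp add: add.assoc)
    then have "\<forall>\<^sub>F n in sequentially. R n < e" by (rule order_tendstoD(2)) (rule e'(1))
    with ev show "\<forall>\<^sub>F n in sequentially. dist (LINT x|leb T. \<bar>g n x - g' n x\<bar>) 0 < e"
    proof eventually_elim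
      case (elim n)
      define I1 I2 I3 where "I1 = (LINT x|leb T. \<bar>g n x\<bar> powr s n)" "I2 = (LINT x|leb T. \<bar>g' n x\<bar> powr s n)"
        "I3 = (LINT x|leb T. \<bar>k n x\<bar> powr s n)"
      have int: "integrable (leb T) (\<lambda>x. \<bar>g n x - g' n x\<bar>)"
        using periodic_pair_integrable[OF W(1) s1(3)] periodic_pair_integrable[OF W(2) s1(4)] by simp
      have "(LINT x|leb T. \<bar>g n x - g' n x\<bar>)
          \<le> (LINT x|leb T. e' * (1 + \<bar>g n x\<bar> powr s n + \<bar>g' n x\<bar> powr s n)
               + C * ((\<bar>g n x\<bar> powr s n + \<bar>g' n x\<bar> powr s n) / 2 - \<bar>k n x\<bar> powr s n))"
      proof (rule integral_mono[OF int])
        show "integrable (leb T) (\<lambda>x. e' * (1 + \<bar>g n x\<bar> powr s n + \<bar>g' n x\<bar> powr s n)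
               + C * ((\<bar>g n x\<bar> powr s n + \<bar>g' n x\<bar> powr s n) / 2 - \<bar>k n x\<bar> powr s n))"
          by (intro Bochner_Integration.integrable_add Bochner_Integration.integrable_diff
              integrable_mult_right integrable_divide_zero i1 i2 iz integrable_const_leb)
        fix x
        have kx: "k n x = (g n x + g' n x) / 2" by (simp add: k_def field_simps)
        show "\<bar>g n x - g' n x\<bar> \<le> e' * (1 + \<bar>g n x\<bar> powr s n + \<bar>g' n x\<bar> powr s n)
               + C * ((\<bar>g n x\<bar> powr s n + \<bar>g' n x\<bar> powr s n) / 2 - \<bar>k n x\<bar> powr s n)"
          unfolding kx by (rule C(2)[OF rs(1) P])
      qed
      also have "\<dots> = e' * (T + I1 + I2) + C * ((I1 + I2) / 2 - I3)"
        unfolding I1_I2_I3_def using i1[of n] i2[of n] iz[of n] integrable_const_leb[of T] LINT_const_leb[OF T, of 1]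
        by simp
      also have "\<dots> \<le> R n"
      proof -
        have "I1 \<le> A1 n" "I2 \<le> A2 n" "b n \<le> I3" using A1 A2 elim(1) unfolding I1_I2_I3_def by auto
        then have le: "T + I1 + I2 \<le> T + A1 n + A2 n" "(I1 + I2) / 2 - I3 \<le> (A1 n + A2 n) / 2 - b n"
          by (auto intro!: diff_mono divide_right_mono add_mono)
        show ?thesis unfolding R_def
          by (rule add_mono[OF mult_left_mono[OF le(1) less_imp_le[OF e'(2)]] mult_left_mono[OF le(2) C(1)]])
      qed
      finally have "(LINT x|leb T. \<bar>g n x - g' n x\<bar>) < e" using elim by simp
      moreover have "(LINT x|leb T. \<bar>g n x - g' n x\<bar>) \<ge> 0"
        by (rule Bochner_Integration.integral_nonneg) simp
      ultimately show ?case by simp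
    qed
  qed
qed

text \<open>Energies and \<open>lambda_plus\<close> share one limit \<open>L\<close>, so the
  derivative parts of the energies converge, as the comparison with midpoints requires. Convergence
  in L1 carries the weak derivative to the limit, almost everywhere convergence the energy
  bound.\<close>

lemma minimising_limit:
  assumes T: "T > 0" and q: "continuous_on {0..T} q" "\<forall>x\<in>{0..T}. q x \<ge> 0" and w: "continuous_on {0..T} w"
    and r: "1 < r" "\<And>n. r \<le> p n" and p: "p \<longlonglongrightarrow> p0"
    and W: "\<And>n. periodic_pair T (p n) (u n) (g n)" and m: "\<And>n. mass T w (p n) (u n) = 1"
    and B: "\<And>n x. x \<in> {0..T} \<Longrightarrow> \<bar>u n x\<bar> \<le> B"
    and v: "continuous_on {0..T} v" "\<And>x. x \<in> {0..T} \<Longrightarrow> (\<lambda>n. u n x) \<longlonglongrightarrow> v x"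
    and E: "(\<lambda>n. energy T q (p n) (u n) (g n)) \<longlonglongrightarrow> L"
    and lam: "(\<lambda>n. lambda_plus T q w (p n)) \<longlonglongrightarrow> L"
  shows "\<exists>h. periodic_pair T p0 v h \<and> mass T w p0 v = 1 \<and> energy T q p0 v h \<le> L"
proof -
  define a where "a = L - mass T q p0 v"
  have p1: "1 \<le> p n" "0 < p n" for n using r(1) r(2)[of n] by auto
  have "r \<le> p0" using LIMSEQ_le_const[OF p] r(2) by blast
  then have p0: "0 < p0" "1 \<le> p0" using r(1) by auto
  note [measurable] = periodic_pairD(4)[OF W]
  have ig: "integrable (leb T) (g n)" for n by (rule periodic_pair_integrable[OF W p1(1)])
  have ip: "integrable (leb T) (\<lambda>x. \<bar>g n x\<bar> powr p n)" for n by (rule periodic_pairD(5)[OF W])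
  have ml: "(\<lambda>n. mass T c (p n) (u n)) \<longlonglongrightarrow> mass T c p0 v" if "continuous_on {0..T} c" for c
    by (rule mass_tendsto[OF that periodic_pairD(1)[OF W] v(1) B v(2) p p0(1) p1(2)])
  have m0: "mass T w p0 v = 1" using LIMSEQ_unique[OF ml[OF w]] m by simp
  have es: "energy T q (p n) (u n) (g n) = (LINT x|leb T. \<bar>g n x\<bar> powr p n) + mass T q (p n) (u n)" for n
    by (rule energy_split[OF ip q(1) periodic_pairD(1)[OF W] p1(2)])
  have A: "(\<lambda>n. LINT x|leb T. \<bar>g n x\<bar> powr p n) \<longlonglongrightarrow> a"
    using tendsto_diff[OF E ml[OF q(1)]] unfolding es a_def by simp
  \<comment> \<open>If this failed, two index sequences would keep their derivatives apart in L1,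
    although both consist of almost-minimisers with the same limit \<open>v\<close>.\<close>
  have cauchy: "\<exists>N. \<forall>i\<ge>N. \<forall>j\<ge>N. (LINT x|leb T. norm (g i x - g j x)) < e" if e: "e > 0" for e
  proof (rule ccontr)
    assume "\<not> ?thesis"
    then have "\<forall>N. \<exists>i j. i \<ge> N \<and> j \<ge> N \<and> \<not> (LINT x|leb T. norm (g i x - g j x)) < e" by blast
    then obtain i j where ij: "\<And>N. i N \<ge> N" "\<And>N. j N \<ge> N"
        "\<And>N. \<not> (LINT x|leb T. norm (g (i N) x - g (j N) x)) < e" by metis
    have fi: "filterlim i at_top sequentially" "filterlim j at_top sequentially"
      using ij(1,2) by (auto intro: filterlim_at_top_mono[OF filterlim_ident])
    \<comment> \<open>The index with the smaller exponent. It selects from the given sequence, so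
      \<open>lambda_plus\<close> at the smaller exponent tends to \<open>L\<close> by
      hypothesis.\<close>
    define f where "f = (\<lambda>N. if p (i N) \<le> p (j N) then i N else j N)"
    have "filterlim f at_top sequentially"
      by (rule filterlim_at_top_mono[OF filterlim_ident]) (use ij(1,2) in \<open>auto simp: f_def\<close>)
    from filterlim_compose[OF lam this]
    have lf: "(\<lambda>N. lambda_plus T q w (p (f N))) \<longlonglongrightarrow> L" .
    have "p (f N) = min (p (i N)) (p (j N))" for N by (auto simp: f_def)
    then have lf: "(\<lambda>N. lambda_plus T q w (min (p (i N)) (p (j N)))) \<longlonglongrightarrow> L" using lf by simp
    have "(\<lambda>N. LINT x|leb T. \<bar>g (i N) x - g (j N) x\<bar>) \<longlonglongrightarrow> 0"
    proof (rule almost_minimisers_L1_close[OF T q w r(1), where v = v and B = B])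
      show "(\<lambda>N. p (i N)) \<longlonglongrightarrow> p0" "(\<lambda>N. p (j N)) \<longlonglongrightarrow> p0"
        by (rule filterlim_compose[OF p], rule fi)+
      show "(\<lambda>N. u (i N) x) \<longlonglongrightarrow> v x" "(\<lambda>N. u (j N) x) \<longlonglongrightarrow> v x" if "x \<in> {0..T}" for x
        by (rule filterlim_compose[OF v(2)[OF that]], rule fi)+
      show "(\<lambda>N. LINT x|leb T. \<bar>g (i N) x\<bar> powr p (i N)) \<longlonglongrightarrow> L - mass T q p0 v"
        "(\<lambda>N. LINT x|leb T. \<bar>g (j N) x\<bar> powr p (j N)) \<longlonglongrightarrow> L - mass T q p0 v"
        by (rule filterlim_compose[OF A[unfolded a_def]], rule fi)+
    qed (use r W B v m0 lf in auto)
    then have "\<forall>\<^sub>F N in sequentially. (LINT x|leb T. \<bar>g (i N) x - g (j N) x\<bar>) < e"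
      by (rule order_tendstoD(2)) (rule e)
    then show False using ij(3) by (auto dest: eventually_happens)
  qed
  obtain k where k: "strict_mono k" "AE x in leb T. Cauchy (\<lambda>n. g (k n) x)"
    using cauchy_L1_AE_cauchy_subseq[OF ig cauchy] by blast
  define h where "h = (\<lambda>x. lim (\<lambda>n. g (k n) x))"
  have [measurable]: "h \<in> borel_measurable (leb T)"
    unfolding h_def by (intro borel_measurable_lim_metric) measurable
  have hl: "AE x in leb T. (\<lambda>n. g (k n) x) \<longlonglongrightarrow> h x"
    using k(2) unfolding h_def by eventually_elim (simp add: Cauchy_convergent_iff convergent_LIMSEQ_iff)
  have kl: "filterlim k at_top sequentially" by (rule filterlim_subseq[OF k(1)])
  have hp: "integrable (leb T) (\<lambda>x. \<bar>h x\<bar> powr p0)" "(LINT x|leb T. \<bar>h x\<bar> powr p0) \<le> a"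
  proof -
    have lim: "AE x in leb T. (\<lambda>n. \<bar>g (k n) x\<bar> powr p (k n)) \<longlonglongrightarrow> \<bar>h x\<bar> powr p0"
      using hl
    proof eventually_elim
      case (elim x)
      then show ?case
        using p0 by (intro tendsto_powr' tendsto_rabs filterlim_compose[OF p kl]) auto
    qed
    have meas: "(\<lambda>x. \<bar>h x\<bar> powr p0) \<in> borel_measurable (leb T)" by measurable
    note F = Fatou_real[OF ip _ meas lim order_refl filterlim_compose[OF A kl]]
    show "integrable (leb T) (\<lambda>x. \<bar>h x\<bar> powr p0)" "(LINT x|leb T. \<bar>h x\<bar> powr p0) \<le> a"
      using F by auto
  qed
  have ih: "integrable (leb T) h" by (rule integrable_of_powr[OF _ hp(1) p0(2)]) measurable
  have L1: "(\<lambda>n. LINT x|leb T. \<bar>g (k n) x - h x\<bar>) \<longlonglongrightarrow> 0"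
  proof (rule tendstoI)
    fix e :: real assume e: "e > 0"
    obtain N where N: "\<And>i j. i \<ge> N \<Longrightarrow> j \<ge> N \<Longrightarrow> (LINT x|leb T. norm (g i x - g j x)) < e / 2"
      using cauchy[OF half_gt_zero[OF e]] by blast
    have "dist (LINT x|leb T. \<bar>g (k n) x - h x\<bar>) 0 < e" if n: "n \<ge> N" for n
    proof -
      \<comment> \<open>For fixed \<open>n\<close> the second index tends to infinity, and Fatou's
        lemma turns the Cauchy estimate into one against the limit. The shift by \<open>N\<close>
        keeps all indices in the Cauchy range.\<close>
      have lim: "AE x in leb T. (\<lambda>j. \<bar>g (k n) x - g (k (j + N)) x\<bar>) \<longlonglongrightarrow> \<bar>g (k n) x - h x\<bar>"
        using hl
      proof eventually_elim
        case (elim x)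
        show ?case by (intro tendsto_rabs tendsto_diff tendsto_const LIMSEQ_ignore_initial_segment elim)
      qed
      have "(LINT x|leb T. \<bar>g (k n) x - g (k (j + N)) x\<bar>) \<le> e / 2" for j
        using N[of "k n" "k (j + N)"] seq_suble[OF k(1), of n] seq_suble[OF k(1), of "j + N"] n by simp
      then have "(LINT x|leb T. \<bar>g (k n) x - h x\<bar>) \<le> e / 2"
        by (intro Fatou_real(2)[OF _ _ _ lim _ tendsto_const] integrable_abs Bochner_Integration.integrable_diff ig)
          auto
      moreover have "0 \<le> (LINT x|leb T. \<bar>g (k n) x - h x\<bar>)" by (rule Bochner_Integration.integral_nonneg) simp
      ultimately show ?thesis using e by simp
    qed
    then show "\<forall>\<^sub>F n in sequentially. dist (LINT x|leb T. \<bar>g (k n) x - h x\<bar>) 0 < e"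
      by (rule eventually_sequentiallyI)
  qed
  have "periodic_pair T p0 v h"
  proof (rule periodic_pairI[OF v(1) _ _ p0(1) hp(1)])
    have T0: "0 \<in> {0..T}" "T \<in> {0..T}" using T by auto
    show "v 0 = v T"
      using LIMSEQ_unique[OF v(2)[OF T0(1)]] v(2)[OF T0(2)] periodic_pairD(2)[OF W] by simp
    show "h \<in> borel_measurable (leb T)" by measurable
    fix \<phi> assume phi: "\<phi> \<in> test_functions {0<..<T}"
    note c = test_functionsD(1,2)[OF phi, of "{0..T}"]
    obtain D where D: "\<And>x. x \<in> {0..T} \<Longrightarrow> \<bar>\<phi> x\<bar> \<le> D" "D \<ge> 1" using continuous_bounded_Icc[OF c(1)] by metis
    obtain D' where D': "\<And>x. x \<in> {0..T} \<Longrightarrow> \<bar>deriv \<phi> x\<bar> \<le> D'" "D' \<ge> 1" using continuous_bounded_Icc[OF c(2)] by metis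
    note [measurable] = borel_measurable_leb_continuous[OF c(1)] borel_measurable_leb_continuous[OF c(2)]
      borel_measurable_leb_continuous[OF v(1)] periodic_pairD(3)[OF W]
    have l1: "(\<lambda>n. LINT x|leb T. u (k n) x * deriv \<phi> x) \<longlonglongrightarrow> (LINT x|leb T. v x * deriv \<phi> x)"
    proof (rule integral_dominated_convergence[where w = "\<lambda>x. B * D'"])
      show "AE x in leb T. (\<lambda>n. u (k n) x * deriv \<phi> x) \<longlonglongrightarrow> v x * deriv \<phi> x"
        by (intro AE_I2 tendsto_mult tendsto_const filterlim_compose[OF v(2) kl]) auto
      show "AE x in leb T. norm (u (k n) x * deriv \<phi> x) \<le> B * D'" for n
      proof (rule AE_I2)
        fix x assume "x \<in> space (leb T)"
        then have x: "x \<in> {0..T}" by simp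
        have "\<bar>u (k n) x\<bar> * \<bar>deriv \<phi> x\<bar> \<le> B * D'"
          using B[OF x, of "k n"] D'(1)[OF x] by (intro mult_mono) auto
        then show "norm (u (k n) x * deriv \<phi> x) \<le> B * D'" by (simp add: abs_mult)
      qed
    qed (auto intro: integrable_const_leb)
    have i\<phi>: "integrable (leb T) (\<lambda>x. f x * \<phi> x)" if "integrable (leb T) f" for f
      using integrable_leb_mult_bounded[OF that borel_measurable_leb_continuous[OF c(1)], of D] D(1)
      by (simp add: mult.commute)
    have "(\<lambda>n. (LINT x|leb T. g (k n) x * \<phi> x) - (LINT x|leb T. h x * \<phi> x)) \<longlonglongrightarrow> 0"
    proof (rule Lim_null_comparison)
      show "(\<lambda>n. D * (LINT x|leb T. \<bar>g (k n) x - h x\<bar>)) \<longlonglongrightarrow> 0"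
        using tendsto_mult_left[OF L1, of D] by simp
      have "norm ((LINT x|leb T. g (k n) x * \<phi> x) - (LINT x|leb T. h x * \<phi> x))
          \<le> D * (LINT x|leb T. \<bar>g (k n) x - h x\<bar>)" for n
      proof -
        have "(LINT x|leb T. g (k n) x * \<phi> x) - (LINT x|leb T. h x * \<phi> x)
            = (LINT x|leb T. g (k n) x * \<phi> x - h x * \<phi> x)"
          by (rule Bochner_Integration.integral_diff[symmetric, OF i\<phi>[OF ig] i\<phi>[OF ih]])
        also have "\<bar>\<dots>\<bar> \<le> (LINT x|leb T. D * \<bar>g (k n) x - h x\<bar>)"
        proof (rule integral_abs_bound_integral)
          show "integrable (leb T) (\<lambda>x. g (k n) x * \<phi> x - h x * \<phi> x)"
            by (intro Bochner_Integration.integrable_diff i\<phi> ig ih)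
          show "integrable (leb T) (\<lambda>x. D * \<bar>g (k n) x - h x\<bar>)"
            by (intro integrable_mult_right integrable_abs Bochner_Integration.integrable_diff ig ih)
          fix x assume "x \<in> space (leb T)"
          then have "\<bar>\<phi> x\<bar> * \<bar>g (k n) x - h x\<bar> \<le> D * \<bar>g (k n) x - h x\<bar>"
            using D(1)[of x] by (intro mult_right_mono) auto
          moreover have "g (k n) x * \<phi> x - h x * \<phi> x = \<phi> x * (g (k n) x - h x)"
            by (simp add: algebra_simps)
          ultimately show "\<bar>g (k n) x * \<phi> x - h x * \<phi> x\<bar> \<le> D * \<bar>g (k n) x - h x\<bar>"
            by (simp only: abs_mult)
        qed
        finally show ?thesis by simp
      qed
      then show "\<forall>\<^sub>F n in sequentially. norm ((LINT x|leb T. g (k n) x * \<phi> x) - (LINT x|leb T. h x * \<phi> x))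
          \<le> D * (LINT x|leb T. \<bar>g (k n) x - h x\<bar>)" by (rule always_eventually[OF allI])
    qed
    then have "(\<lambda>n. LINT x|leb T. g (k n) x * \<phi> x) \<longlonglongrightarrow> (LINT x|leb T. h x * \<phi> x)" by (simp add: LIM_zero_iff)
    from tendsto_minus[OF this] have "(\<lambda>n. LINT x|leb T. u (k n) x * deriv \<phi> x) \<longlonglongrightarrow> - (LINT x|leb T. h x * \<phi> x)"
      by (simp add: periodic_pairD(6)[OF W phi])
    with l1 show "(LINT x|leb T. v x * deriv \<phi> x) = - (LINT x|leb T. h x * \<phi> x)" by (rule LIMSEQ_unique)
  qed
  moreover have "energy T q p0 v h \<le> L"
    using energy_split[OF hp(1) q(1) v(1) p0(1)] hp(2) by (simp add: a_def)
  ultimately show ?thesis using m0 by blast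
qed

section \<open>Compactness, attainment and continuity\<close>

lemma seq_bounds_gt:
  fixes p :: "nat \<Rightarrow> real"
  assumes "p \<longlonglongrightarrow> p0" "\<And>n. p n > c" "p0 > c"
  obtains r where "r > c" "\<And>n. r \<le> p n"
proof -
  have "compact (insert p0 (range p))" by (rule compact_sequence_with_limit[OF assms(1)])
  then obtain r where "r \<in> insert p0 (range p)" "\<And>t. t \<in> insert p0 (range p) \<Longrightarrow> r \<le> t"
    using compact_attains_inf[of "insert p0 (range p)"] by blast
  then show ?thesis using that[of r] assms by auto
qed

text \<open>Stated for varying exponents because it serves two purposes: a constant sequence of
  exponents gives attainment, exponents tending to \<open>p0\<close> give lower
  semicontinuity.\<close>

lemma compactness:
  assumes T: "T > 0" and q: "continuous_on {0..T} q" "\<forall>x\<in>{0..T}. q x \<ge> 0" "\<exists>x\<in>{0..T}. q x \<noteq> 0"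
    and w: "continuous_on {0..T} w"
    and p: "p \<longlonglongrightarrow> p0" "\<And>n. p n > 1" "p0 > 1"
    and E: "\<And>n. E n \<in> constrained_energies T q w (p n)" "E \<longlonglongrightarrow> L"
    and lam: "(\<lambda>n. lambda_plus T q w (p n)) \<longlonglongrightarrow> L"
  shows "\<exists>E\<in>constrained_energies T q w p0. E \<le> L"
proof -
  \<comment> \<open>A convergent sequence together with its limit is compact, so the exponents stay
    above some \<open>r > 1\<close>; superlinearity and strict convexity are uniform only from such
    an \<open>r\<close> on.\<close>
  obtain r where r: "1 < r" "\<And>n. r \<le> p n" using seq_bounds_gt[OF p(1,2,3)] by metis
  have "\<forall>n. \<exists>u g. periodic_pair T (p n) u g \<and> mass T w (p n) u = 1 \<and> energy T q (p n) u g = E n"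
    using E(1) unfolding constrained_energies_eq by force
  then obtain u g where W: "\<And>n. periodic_pair T (p n) (u n) (g n)" and m: "\<And>n. mass T w (p n) (u n) = 1"
    and En: "\<And>n. energy T q (p n) (u n) (g n) = E n" by metis
  have p1: "1 \<le> p n" "0 < p n" for n using p(2)[of n] by auto
  obtain K where K: "\<And>n. E n \<le> K"
    using convergent_imp_Bseq[OF convergentI[OF E(2)]] by (metis Bseq_def abs_le_D1 real_norm_def)
  have K0: "K \<ge> 0" using constrained_energies_nonneg[OF q(2) E(1)] K order_trans by blast
  define B where "B = 1 + K / (LINT x|leb T. q x) + (K + T)"
  have B: "\<bar>u n x\<bar> \<le> B" if "x \<in> {0..T}" for n x
    unfolding B_def by (rule periodic_pair_bounded[OF T q W p1(1) _ that]) (simp add: En K)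
  have gK: "(LINT x|leb T. \<bar>g n x\<bar> powr p n) \<le> K" for n
    using energy_split[OF periodic_pairD(5)[OF W] q(1) periodic_pairD(1)[OF W] p1(2), of n]
      mass_nonneg[OF q(2), of "p n" "u n"] K[of n] En[of n] by simp
  have equi: "\<exists>d. 0 < d \<and> (\<forall>n y. y \<in> {0..T} \<and> norm (x - y) < d \<longrightarrow> norm (u n x - u n y) < e)"
    if x: "x \<in> {0..T}" and e: "0 < e" for x e
  proof -
    obtain d where "d > 0"
      "\<And>p u g x y. r \<le> p \<Longrightarrow> periodic_pair T p u g \<Longrightarrow> (LINT x|leb T. \<bar>g x\<bar> powr p) \<le> K \<Longrightarrow>
       x \<in> {0..T} \<Longrightarrow> y \<in> {0..T} \<Longrightarrow> \<bar>x - y\<bar> < d \<Longrightarrow> \<bar>u x - u y\<bar> < e"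
      using periodic_pair_equicontinuous[OF r(1) K0 e, of T] by metis
    then show ?thesis using r(2) W gK x by (metis real_norm_def)
  qed
  obtain v k where v: "continuous_on {0..T} v" "strict_mono (k :: nat \<Rightarrow> nat)"
      "\<And>e. 0 < e \<Longrightarrow> \<exists>N. \<forall>n x. n \<ge> N \<and> x \<in> {0..T} \<longrightarrow> norm (u (k n) x - v x) < e"
    using Arzela_Ascoli[of "{0..T}" u B, OF compact_Icc] B equi by (metis real_norm_def)
  have vl: "(\<lambda>n. u (k n) x) \<longlonglongrightarrow> v x" if "x \<in> {0..T}" for x
    by (rule LIMSEQ_I) (use v(3) that in blast)
  have kl: "filterlim k at_top sequentially" by (rule filterlim_subseq[OF v(2)])
  have "\<exists>h. periodic_pair T p0 v h \<and> mass T w p0 v = 1 \<and> energy T q p0 v h \<le> L"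
  proof (rule minimising_limit[OF T q(1,2) w r(1), where B = B])
    show "(\<lambda>n. p (k n)) \<longlonglongrightarrow> p0" by (rule filterlim_compose[OF p(1) kl])
    show "(\<lambda>n. energy T q (p (k n)) (u (k n)) (g (k n))) \<longlonglongrightarrow> L"
      unfolding En by (rule filterlim_compose[OF E(2) kl])
    show "(\<lambda>n. lambda_plus T q w (p (k n))) \<longlonglongrightarrow> L" by (rule filterlim_compose[OF lam kl])
  qed (use r W m B v(1) vl in auto)
  then show ?thesis unfolding constrained_energies_eq by blast
qed

lemma lambda_plus_attained:
  assumes T: "T > 0" and q: "continuous_on {0..T} q" "\<forall>x\<in>{0..T}. q x \<ge> 0" "\<exists>x\<in>{0..T}. q x \<noteq> 0"
    and w: "continuous_on {0..T} w" "\<exists>x\<in>{0..T}. w x > 0" and p: "p > 1"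
  shows "lambda_plus T q w p \<in> constrained_energies T q w p"
proof -
  have ne: "constrained_energies T q w p \<noteq> {}"
    using constrained_energies_nonempty[OF T w] p by simp
  have "\<exists>E\<in>constrained_energies T q w p. E < lambda_plus T q w p + 1 / real (Suc n)" for n
    by (rule near_infimum[OF ne]) simp
  then obtain E where E: "\<And>n. E n \<in> constrained_energies T q w p" "\<And>n. E n < lambda_plus T q w p + 1 / real (Suc n)"
    by metis
  have "(\<lambda>n. lambda_plus T q w p + 1 / real (Suc n)) \<longlonglongrightarrow> lambda_plus T q w p + 0"
    by (intro tendsto_add tendsto_const LIMSEQ_Suc[OF lim_1_over_n])
  then have El: "E \<longlonglongrightarrow> lambda_plus T q w p"
    using lambda_plus_lower[OF q(2) E(1)] E(2)
    by (intro tendsto_sandwich[OF _ _ tendsto_const, of "lambda_plus T q w p" E])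
       (auto intro!: always_eventually less_imp_le)
  obtain E' where "E' \<in> constrained_energies T q w p" "E' \<le> lambda_plus T q w p"
    using compactness[OF T q w(1) tendsto_const p p E(1) El tendsto_const] by blast
  then show ?thesis using lambda_plus_lower[OF q(2), of E' w p] by simp
qed

lemma lambda_plus_continuous:
  assumes T: "T > 0" and q: "continuous_on {0..T} q" "\<forall>x\<in>{0..T}. q x \<ge> 0" "\<exists>x\<in>{0..T}. q x \<noteq> 0"
    and w: "continuous_on {0..T} w" "\<exists>x\<in>{0..T}. w x > 0"
  shows "continuous_on {1<..} (lambda_plus T q w)"
  unfolding continuous_on_sequentially
proof (intro allI ballI impI, elim conjE)
  fix p :: "nat \<Rightarrow> real" and p0 :: real
  assume p0: "p0 \<in> {1<..}" and p: "\<forall>n. p n \<in> {1<..}" "p \<longlonglongrightarrow> p0"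
  define l where "l = lambda_plus T q w"
  have ne: "constrained_energies T q w r \<noteq> {}" if "r > 1" for r
    using constrained_energies_nonempty[OF T w] that by simp
  have "\<forall>\<^sub>F n in sequentially. l (p n) > c" if c: "c < l p0" for c
  proof (rule ccontr)
    assume "\<not> ?thesis"
    \<comment> \<open>A failure of lower semicontinuity puts infinitely many values into the compact
      interval from 0 to \<open>c\<close>. A further subsequence supplies the convergence of
      \<open>lambda_plus\<close> to some \<open>L <= c\<close> that \<open>compactness\<close>
      presupposes, and its consequence \<open>l p0 <= L\<close> contradicts
      \<open>c < l p0\<close>.\<close>
    then have inf: "infinite {n. l (p n) \<le> c}"
      by (simp add: not_eventually frequently_cofinite not_less flip: cofinite_eq_sequentially)
    define s where "s = enumerate {n. l (p n) \<le> c}"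
    have s: "strict_mono s" "\<And>n. l (p (s n)) \<le> c"
      using strict_mono_enumerate[OF inf] enumerate_in_set[OF inf] by (auto simp: s_def)
    have l0: "0 \<le> l r" if "r > 1" for r
      unfolding l_def lambda_plus_def
      by (rule cInf_greatest[OF ne[OF that] constrained_energies_nonneg[OF q(2)]])
    have "\<forall>n. l (p (s n)) \<in> {0..c}" using s(2) l0 p(1) by auto
    then obtain L t where L: "L \<in> {0..c}" and t: "strict_mono t" "((\<lambda>n. l (p (s n))) \<circ> t) \<longlonglongrightarrow> L"
      using compact_Icc[of 0 c] unfolding compact_def by (metis (no_types, lifting))
    define p' where "p' = (\<lambda>n. p (s (t n)))"
    have p': "p' \<longlonglongrightarrow> p0" unfolding p'_def
      using filterlim_compose[OF p(2) filterlim_subseq[OF strict_mono_o[OF s(1) t(1)]]] by simp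
    have p1: "p' n > 1" for n using p(1) by (simp add: p'_def)
    have lim: "(\<lambda>n. l (p' n)) \<longlonglongrightarrow> L" using t(2) by (simp add: p'_def o_def)
    have "\<exists>E\<in>constrained_energies T q w (p' n). E < l (p' n) + 1 / real (Suc n)" for n
      unfolding l_def by (rule near_infimum[OF ne[OF p1]]) simp
    then obtain E where E: "\<And>n. E n \<in> constrained_energies T q w (p' n)" "\<And>n. E n < l (p' n) + 1 / real (Suc n)"
      by metis
    have "(\<lambda>n. l (p' n) + 1 / real (Suc n)) \<longlonglongrightarrow> L + 0"
      by (intro tendsto_add lim LIMSEQ_Suc[OF lim_1_over_n])
    then have El: "E \<longlonglongrightarrow> L"
      using lambda_plus_lower[OF q(2) E(1)] E(2)
      by (intro tendsto_sandwich[OF _ _ lim, of E]) (auto intro!: always_eventually less_imp_le simp: l_def)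
    obtain E' where "E' \<in> constrained_energies T q w p0" "E' \<le> L"
      using compactness[OF T q w(1) p' p1 _ E(1) El lim[unfolded l_def]] p0 by auto
    then have "l p0 \<le> L" using lambda_plus_lower[OF q(2), of E' w p0] by (simp add: l_def)
    then show False using L c by simp
  qed
  moreover have "\<forall>\<^sub>F n in sequentially. l (p n) < c" if c: "l p0 < c" for c
    using lambda_plus_upper_semicontinuous[OF T q(1,2) w(1) ne p(2), of "c - l p0"] p0 p(1) c
    by (simp add: l_def)
  ultimately show "(lambda_plus T q w \<circ> p) \<longlonglongrightarrow> lambda_plus T q w p0"
    unfolding l_def o_def by (intro order_tendstoI)
qed

lemma lambda_minus_eq:
  assumes T: "T > 0" and q: "continuous_on {0..T} q" "\<forall>x\<in>{0..T}. q x \<ge> 0" "\<exists>x\<in>{0..T}. q x \<noteq> 0"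
    and m: "continuous_on {0..T} m" "\<exists>x\<in>{0..T}. m x < 0" and p: "p > 1"
  shows "lambda_minus T q m p = - lambda_plus T q (\<lambda>x. - m x) p"
  unfolding lambda_minus_def
proof (rule Greatest_equality)
  have "continuous_on {0..T} (\<lambda>x. - m x)" by (rule continuous_on_minus[OF m(1)])
  moreover have "\<exists>x\<in>{0..T}. - m x > 0" using m(2) by simp
  ultimately show "- lambda_plus T q (\<lambda>x. - m x) p \<in> uminus ` constrained_energies T q (\<lambda>x. - m x) p"
    by (intro imageI lambda_plus_attained[OF T q _ _ p])
  show "y \<le> - lambda_plus T q (\<lambda>x. - m x) p" if "y \<in> uminus ` constrained_energies T q (\<lambda>x. - m x) p" for y
    using that lambda_plus_lower[OF q(2)] by auto
qed

theorem proposition3p2: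
  fixes T :: real and q m :: "real \<Rightarrow> real"
  assumes "T > 0"
    and "continuous_on {0..T} q" and "\<forall>x\<in>{0..T}. q x \<ge> 0" and "\<exists>x\<in>{0..T}. q x \<noteq> 0"
    and "continuous_on {0..T} m" and "\<exists>x\<in>{0..T}. m x > 0" and "\<exists>x\<in>{0..T}. m x < 0"
  shows "continuous_on {1<..} (\<lambda>p. lambda_plus T q m p) \<and>
         continuous_on {1<..} (\<lambda>p. lambda_minus T q m p)"
proof
  show "continuous_on {1<..} (\<lambda>p. lambda_plus T q m p)"
    by (rule lambda_plus_continuous[OF assms(1-6)])
  have "continuous_on {0..T} (\<lambda>x. - m x)" by (rule continuous_on_minus[OF assms(5)])
  moreover have "\<exists>x\<in>{0..T}. - m x > 0" using assms(7) by simp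
  ultimately have "continuous_on {1<..} (\<lambda>p. - lambda_plus T q (\<lambda>x. - m x) p)"
    by (rule continuous_on_minus[OF lambda_plus_continuous[OF assms(1-4)]])
  then show "continuous_on {1<..} (\<lambda>p. lambda_minus T q m p)"
    by (rule continuous_on_eq) (use lambda_minus_eq[OF assms(1-5,7)] in auto)
qed

end
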